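(* Let $f:\mathbb{R}^d\to\mathbb{R}$ be $L$-smooth and convex with nonempty set of minimizers $X_\star$, and suppose for some $\mu>0$ and $p\ge2$ that $f(x)-f_\star\ge\mu\operatorname{dist}(x,X_\star)^p$ for all $x$ with $f(x)\le f(x^{(0)})$. Let $\Delta_0=f(x^{(0)})-f_\star$ and $0<\epsilon<\Delta_0$. Run the Dynamic Restarting Scheme (described in the context) from $x^{(0)}$ with $\mathtt{fom}(\epsilon)$ equal to the accelerated method (described in the context) and $N_0=1$. (i) If $p>2$ and $\epsilon_k=\frac{\epsilon}{2e}\exp(c^k)$ for any $c\in(1,\frac32-\frac1p)$, then the scheme computes an $\epsilon$-optimal solution with iteration complexity and oracle complexity respectively at most $$\mathcal{O}\left(\frac{\sqrt L}{\mu^{1/p}}\cdot\frac1{\epsilon^{\frac12-\frac1p}}\right)\quad\text{and}\quad\mathcal{O}\left(\frac{\sqrt L}{\mu^{1/p}}\cdot\frac1{\epsilon^{\frac12-\frac1p}}\cdot\log\log\left(\frac{\Delta_0}{\epsilon}\right)\right).$$ (ii) If $p=2$ and $\epsilon_k=\frac\epsilon2c^k$ for any $c>1$, then the scheme computes an $\epsilon$-optimal solution with iteration complexity and oracle complexity respectively at most $$\mathcal{O}\left(\sqrt{\frac L\mu}\log\left(\frac{\Delta_0}{\epsilon}\right)\right)\quad\text{and}\quad\mathcal{O}\left(\sqrt{\frac L\mu}\left(\log\left(\frac{\Delta_0}{\epsilon}\right)\right)^2\right).$$ In either case no other choice of $\{\epsilon_k\}$ asymptotically improves these rates in the bound $$B(\{\epsilon_k\})=\sum_{k=0}^{m-1}\left(1+\frac{2\epsilon_{k+1}}{\epsilon_k}\right)K_{\mathtt{dec}}\left(\epsilon_k,2\epsilon_k,(2\epsilon_k/\mu)^{1/p}\right),\qquad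 K_{\mathtt{dec}}(\epsilon,\delta,D)=\sqrt{\frac{2LD^2}{\delta-\epsilon}},$$ even in the $\log$ and $\log\log$ factors: over all strictly increasing positive sequences $\{\epsilon_k\}_{k\ge0}$ with $\epsilon_0\le\epsilon/2$ and $\epsilon_k\to\infty$, the infimum of $B(\{\epsilon_k\})$ (iteration bound) and the infimum of $(\hat m+1)B(\{\epsilon_k\})$ (oracle bound) are, respectively, at least of the order ($\Omega$) of the two rates displayed in the relevant case, where $m=\inf\{k:\epsilon_k\ge\Delta_0/2\}$ and $\hat m=\inf\{k:\epsilon_k>\Delta_0\}$.
   Context: Notation: $f_\star=\min f$, $X_\star=\operatorname{argmin} f$, $\operatorname{dist}(y,X_\star)=\inf_{x\in X_\star}\|y-x\|_2$; $L$-smooth means $\nabla f$ is $L$-Lipschitz. $x$ is $\epsilon$-optimal if $f(x)-f_\star\le\epsilon$. Asymptotic notations are with respect to $\epsilon\to0$ ($p$ and $c$ fixed, dependence on $L,\mu,\Delta_0$ as displayed). Iteration complexity is the number of rounds of the scheme until some $\overline x^{(t)}$ (defined below) is $\epsilon$-optimal; oracle complexity is the total number of $\mathtt{fom}$ iterations performed over all processes up to then. Accelerated method (does not depend on $\epsilon$). From initial point $x^{(0)}$: $\theta^{(0)}=1$, $y^{(0)}=x^{(0)}$, and iterate $x^{(k+1)}=y^{(k)}-\frac1L\nabla f(y^{(k)})$, $\theta^{(k+1)}=\frac{1+\sqrt{1+4(\theta^{(k)})^2}}2$, $y^{(k+1)}=x^{(k+1)}+\frac{\theta^{(k)}-1}{\theta^{(k+1)}}(x^{(k+1)}-x^{(k)})$.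 Dynamic Restarting Scheme. Input: $x^{(0)}$, strictly increasing positive targets $\{\epsilon_k\}_{k\ge0}$ with $\epsilon_k\to\infty$, $\mathtt{fom}$, and an initial process count $N_0\ge1$. Process $P_k$ runs $\mathtt{fom}(\epsilon_k)$ and stores a reference point; its task is to obtain a point $\overline x$ with $f(\overline x)\le f(\text{reference point of }P_k)-\epsilon_k$. Round $0$: set $\overline x^{(0)}=x^{(0)}$ and launch $P_0,\dots,P_{N_0-1}$, each with initial point and reference point $x^{(0)}$. Round $t=1,2,\dots$: (Step 1) every process currently in the scheme runs one iteration; let $\overline x^{(t)}$ be an iterate with minimum objective value among all new iterates of this round. (Step 2) For each process $P_k$ that was in the scheme at the beginning of round $t$: if $\overline x^{(t)}$ accomplishes the task of $P_k$, then $P_k$ is restarted at $\overline x^{(t)}$ (its memory is cleared, it then behaves as $\mathtt{fom}(\epsilon_k)$ started from $\overline x^{(t)}$, and its reference point becomes $\overline x^{(t)}$); if moreover $P_k$ is the highest-indexed process entering round $t$, a new process $P_{k+1}$ is launched with initial point and reference point $\overline x^{(t)}$ (its first iteration occurs in round $t+1$). Otherwise $P_k$ continues unchanged. *)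

theory Defs
  imports "HOL-Analysis.Analysis"
begin

section \<open>The spaces R^d, uniformly in d\<close>

text \<open>The constants hidden in the asymptotic bounds must not depend on the dimension, so the
  dimension is quantified inside their scope and cannot be a type parameter. All the spaces
  R^d are therefore realised inside one inner product space, the finitely supported real
  sequences with the Euclidean inner product: R^d consists of the sequences whose
  coordinates with index at least d vanish.\<close>

typedef fsvec = "{x :: nat \<Rightarrow> real. finite {i. x i \<noteq> 0}}"
  morphisms coord Abs_fsvec
  by (rule exI[of _ "\<lambda>_. 0"]) simp

lemma finite_coord [simp]: "finite {i. coord x i \<noteq> 0}"
  using coord[of x] by simp

lemma coord_Abs_fsvec: "finite {i. u i \<noteq> 0} \<Longrightarrow> coord (Abs_fsvec u) = u"
  by (simp add: Abs_fsvec_inverse)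

lemma fsvec_eqI: "(\<And>i. coord x i = coord y i) \<Longrightarrow> x = y"
  by (simp add: coord_inject[symmetric] fun_eq_iff)

instantiation fsvec :: real_vector
begin

definition zero_fsvec :: fsvec where
  "zero_fsvec = Abs_fsvec (\<lambda>_. 0)"

definition plus_fsvec :: "fsvec \<Rightarrow> fsvec \<Rightarrow> fsvec" where
  "plus_fsvec x y = Abs_fsvec (\<lambda>i. coord x i + coord y i)"

definition uminus_fsvec :: "fsvec \<Rightarrow> fsvec" where
  "uminus_fsvec x = Abs_fsvec (\<lambda>i. - coord x i)"

definition minus_fsvec :: "fsvec \<Rightarrow> fsvec \<Rightarrow> fsvec" where
  "minus_fsvec x y = Abs_fsvec (\<lambda>i. coord x i - coord y i)"

definition scaleR_fsvec :: "real \<Rightarrow> fsvec \<Rightarrow> fsvec" where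
  "scaleR_fsvec a x = Abs_fsvec (\<lambda>i. a * coord x i)"

lemma coord_zero [simp]: "coord 0 i = 0"
  by (simp add: zero_fsvec_def coord_Abs_fsvec)

lemma coord_plus [simp]: "coord (x + y) i = coord x i + coord y i"
proof -
  have "finite {i. coord x i + coord y i \<noteq> 0}"
    by (rule finite_subset[of _ "{i. coord x i \<noteq> 0} \<union> {i. coord y i \<noteq> 0}"]) auto
  then show ?thesis by (simp add: plus_fsvec_def coord_Abs_fsvec)
qed

lemma coord_uminus [simp]: "coord (- x) i = - coord x i"
  by (simp add: uminus_fsvec_def coord_Abs_fsvec)

lemma coord_minus [simp]: "coord (x - y) i = coord x i - coord y i"
proof -
  have "finite {i. coord x i - coord y i \<noteq> 0}"
    by (rule finite_subset[of _ "{i. coord x i \<noteq> 0} \<union> {i. coord y i \<noteq> 0}"]) auto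
  then show ?thesis by (simp add: minus_fsvec_def coord_Abs_fsvec)
qed

lemma coord_scaleR [simp]: "coord (a *\<^sub>R x) i = a * coord x i"
proof -
  have "finite {i. a * coord x i \<noteq> 0}"
    by (rule finite_subset[of _ "{i. coord x i \<noteq> 0}"]) auto
  then show ?thesis by (simp add: scaleR_fsvec_def coord_Abs_fsvec)
qed

instance
  by standard (auto intro!: fsvec_eqI simp: algebra_simps)

end

instantiation fsvec :: real_inner
begin

definition inner_fsvec :: "fsvec \<Rightarrow> fsvec \<Rightarrow> real" where
  "inner_fsvec x y = (\<Sum>i | coord x i \<noteq> 0. coord x i * coord y i)"

definition norm_fsvec :: "fsvec \<Rightarrow> real" where
  "norm_fsvec x = sqrt (inner x x)"

definition dist_fsvec :: "fsvec \<Rightarrow> fsvec \<Rightarrow> real" where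
  "dist_fsvec x y = norm (x - y)"

definition sgn_fsvec :: "fsvec \<Rightarrow> fsvec" where
  "sgn_fsvec x = x /\<^sub>R norm x"

definition uniformity_fsvec :: "(fsvec \<times> fsvec) filter" where
  "uniformity_fsvec = (INF e\<in>{0<..}. principal {(x, y). dist x y < e})"

definition open_fsvec :: "fsvec set \<Rightarrow> bool" where
  "open_fsvec U \<longleftrightarrow> (\<forall>x\<in>U. \<forall>\<^sub>F (x', y) in uniformity. x' = x \<longrightarrow> y \<in> U)"

lemma inner_fsvec_eq:
  assumes "finite I" "{i. coord x i \<noteq> 0} \<subseteq> I"
  shows "inner x y = (\<Sum>i\<in>I. coord x i * coord y i)"
  unfolding inner_fsvec_def by (rule sum.mono_neutral_left) (use assms in auto)

instance
proof
  fix x y z :: fsvec and r :: real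
  let ?I = "{i. coord x i \<noteq> 0} \<union> {i. coord y i \<noteq> 0}"
  have fin: "finite ?I" by simp
  show "inner x y = inner y x"
    by (simp add: inner_fsvec_eq[OF fin] mult.commute)
  have "inner (x + y) z = (\<Sum>i\<in>?I. coord (x + y) i * coord z i)"
    by (rule inner_fsvec_eq) auto
  then show "inner (x + y) z = inner x z + inner y z"
    by (simp add: inner_fsvec_eq[OF fin] distrib_right sum.distrib)
  have "inner (r *\<^sub>R x) y = (\<Sum>i\<in>?I. coord (r *\<^sub>R x) i * coord y i)"
    by (rule inner_fsvec_eq) auto
  then show "inner (r *\<^sub>R x) y = r * inner x y"
    by (simp add: inner_fsvec_eq[OF fin] sum_distrib_left mult.assoc)
  show "0 \<le> inner x x"
    by (simp add: inner_fsvec_def sum_nonneg)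
  show "inner x x = 0 \<longleftrightarrow> x = 0"
    by (auto simp: inner_fsvec_def sum_nonneg_eq_0_iff intro!: fsvec_eqI)
qed (simp_all add: norm_fsvec_def dist_fsvec_def sgn_fsvec_def uniformity_fsvec_def
      open_fsvec_def)

end

definition Rspace :: "nat \<Rightarrow> fsvec set" where
  "Rspace d = {x. \<forall>i\<ge>d. coord x i = 0}"

lemma subspace_Rspace: "subspace (Rspace d)"
  by (auto simp: subspace_def Rspace_def)

lemma norm_Rspace:
  assumes "x \<in> Rspace d"
  shows "norm x = sqrt (\<Sum>i<d. (coord x i)\<^sup>2)"
proof -
  have "{i. coord x i \<noteq> 0} \<subseteq> {..<d}"
    using assms by (auto simp: Rspace_def not_less[symmetric])
  then show ?thesis
    by (simp add: norm_fsvec_def inner_fsvec_eq[of "{..<d}"] power2_eq_square)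
qed

lemma Rspace_coords: "\<exists>!x. x \<in> Rspace d \<and> (\<forall>i<d. coord x i = u i)"
proof (rule ex_ex1I)
  have "finite {i. (if i < d then u i else 0) \<noteq> 0}"
    by (rule finite_subset[of _ "{..<d}"]) auto
  then show "\<exists>x. x \<in> Rspace d \<and> (\<forall>i<d. coord x i = u i)"
    by (intro exI[of _ "Abs_fsvec (\<lambda>i. if i < d then u i else 0)"])
       (simp add: Rspace_def coord_Abs_fsvec)
next
  fix x y
  assume "x \<in> Rspace d \<and> (\<forall>i<d. coord x i = u i)" "y \<in> Rspace d \<and> (\<forall>i<d. coord y i = u i)"
  then show "x = y"
    by (intro fsvec_eqI) (metis (mono_tags, lifting) Rspace_def mem_Collect_eq not_le)
qed

section \<open>The problem class\<close>

definition is_gradient :: "'v::real_inner set \<Rightarrow> ('v \<Rightarrow> real) \<Rightarrow> ('v \<Rightarrow> 'v) \<Rightarrow> bool" where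
  "is_gradient S f g \<longleftrightarrow>
     (\<forall>x\<in>S. g x \<in> S \<and> (f has_derivative (\<lambda>h. inner (g x) h)) (at x within S))"

definition minimizers :: "'v set \<Rightarrow> ('v \<Rightarrow> real) \<Rightarrow> 'v set" where
  "minimizers S f = {x. is_arg_min f (\<lambda>y. y \<in> S) x}"

definition min_value :: "'v set \<Rightarrow> ('v \<Rightarrow> real) \<Rightarrow> real" where
  "min_value S f = (INF x\<in>S. f x)"

text \<open>Only the values of \<open>f\<close> and of its gradient \<open>g\<close> on R^d matter.\<close>

definition problem ::
  "real \<Rightarrow> real \<Rightarrow> real \<Rightarrow> real \<Rightarrow> nat \<Rightarrow> (fsvec \<Rightarrow> real) \<Rightarrow> (fsvec \<Rightarrow> fsvec) \<Rightarrow> fsvec \<Rightarrow> bool"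
where
  "problem p L \<mu> \<Delta>0 d f g x0 \<longleftrightarrow>
     convex_on (Rspace d) f \<and>
     is_gradient (Rspace d) f g \<and> L-lipschitz_on (Rspace d) g \<and>
     minimizers (Rspace d) f \<noteq> {} \<and>
     x0 \<in> Rspace d \<and>
     (\<forall>x\<in>Rspace d. f x \<le> f x0 \<longrightarrow>
        f x - min_value (Rspace d) f \<ge> \<mu> * infdist x (minimizers (Rspace d) f) powr p) \<and>
     \<Delta>0 = f x0 - min_value (Rspace d) f"

section \<open>First-order schemes and the accelerated one\<close>

record ('v, 's) fom =
  fom_init :: "'v \<Rightarrow> 's"
  fom_step :: "'s \<Rightarrow> 's"
  fom_iterate :: "'s \<Rightarrow> 'v"

text \<open>The states are the triples of x, y and theta.\<close>

definition accelerated ::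
  "real \<Rightarrow> ('v::real_vector \<Rightarrow> 'v) \<Rightarrow> ('v, 'v \<times> 'v \<times> real) fom"
where
  "accelerated L g =
     \<lparr> fom_init = (\<lambda>x0. (x0, x0, 1)),
       fom_step = (\<lambda>(x, y, \<theta>).
         let x' = y - (1 / L) *\<^sub>R g y;
             \<theta>' = (1 + sqrt (1 + 4 * \<theta>\<^sup>2)) / 2;
             y' = x' + ((\<theta> - 1) / \<theta>') *\<^sub>R (x' - x)
         in (x', y', \<theta>')),
       fom_iterate = fst \<rparr>"

section \<open>The Dynamic Restarting Scheme\<close>

text \<open>The processes in the scheme after a round are those with index less than \<open>nprocs\<close>;
  the fields \<open>pstate\<close> and \<open>refpt\<close> are meaningful for these indices only.\<close>

record ('v, 's) config =
  nprocs :: nat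
  pstate :: "nat \<Rightarrow> 's"
  refpt :: "nat \<Rightarrow> 'v"
  xbar :: 'v

definition scheme_init ::
  "(real \<Rightarrow> ('v, 's) fom) \<Rightarrow> (nat \<Rightarrow> real) \<Rightarrow> nat \<Rightarrow> 'v \<Rightarrow> ('v, 's) config \<Rightarrow> bool"
where
  "scheme_init F eps N0 x0 A \<longleftrightarrow>
     nprocs A = N0 \<and> xbar A = x0 \<and>
     (\<forall>k<N0. pstate A k = fom_init (F (eps k)) x0 \<and> refpt A k = x0)"

text \<open>A round is a relation, because the best new iterate need not be unique.\<close>

definition scheme_round ::
  "('v \<Rightarrow> real) \<Rightarrow> (real \<Rightarrow> ('v, 's) fom) \<Rightarrow> (nat \<Rightarrow> real) \<Rightarrow>
   ('v, 's) config \<Rightarrow> ('v, 's) config \<Rightarrow> bool"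
where
  "scheme_round f F eps A B \<longleftrightarrow>
     (let n = nprocs A;
          new = (\<lambda>k. fom_step (F (eps k)) (pstate A k));
          it = (\<lambda>k. fom_iterate (F (eps k)) (new k));
          success = (\<lambda>k. f (xbar B) \<le> f (refpt A k) - eps k)
      in (\<exists>j<n. xbar B = it j \<and> (\<forall>k<n. f (it j) \<le> f (it k))) \<and>
         (\<forall>k<n. pstate B k = (if success k then fom_init (F (eps k)) (xbar B) else new k) \<and>
                refpt B k = (if success k then xbar B else refpt A k)) \<and>
         (if success (n - 1)
          then nprocs B = n + 1 \<and>
               pstate B n = fom_init (F (eps n)) (xbar B) \<and> refpt B n = xbar B
          else nprocs B = n))"

definition scheme_run ::
  "('v \<Rightarrow> real) \<Rightarrow> (real \<Rightarrow> ('v, 's) fom) \<Rightarrow> (nat \<Rightarrow> real) \<Rightarrow> nat \<Rightarrow> 'v \<Rightarrow>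
   (nat \<Rightarrow> ('v, 's) config) \<Rightarrow> bool"
where
  "scheme_run f F eps N0 x0 R \<longleftrightarrow>
     scheme_init F eps N0 x0 (R 0) \<and> (\<forall>t. scheme_round f F eps (R t) (R (Suc t)))"

lemma scheme_run_exists:
  assumes "0 < N0"
  shows "\<exists>R. scheme_run f F eps N0 x0 R"
proof -
  have start: "\<exists>A. 0 < nprocs A \<and> scheme_init F eps N0 x0 A"
    using assms
    by (intro exI[of _ "\<lparr>nprocs = N0, pstate = (\<lambda>k. fom_init (F (eps k)) x0),
          refpt = (\<lambda>_. x0), xbar = x0\<rparr>"]) (simp add: scheme_init_def)
  have next_round: "\<exists>B. 0 < nprocs B \<and> scheme_round f F eps A B" if n: "0 < nprocs A" for A
  proof -
    define n new it where "n = nprocs A"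
      and "new = (\<lambda>k. fom_step (F (eps k)) (pstate A k))"
      and "it = (\<lambda>k. fom_iterate (F (eps k)) (new k))"
    have "\<exists>j. is_arg_min (\<lambda>k. f (it k)) (\<lambda>k. k \<in> {..<n}) j"
      by (rule ex_is_arg_min_if_finite) (use n in \<open>auto simp: n_def\<close>)
    then obtain j where j: "j < n" "\<forall>k<n. f (it j) \<le> f (it k)"
      by (auto simp: is_arg_min_linorder)
    define success where "success = (\<lambda>k. f (it j) \<le> f (refpt A k) - eps k)"
    define B where "B =
      \<lparr>nprocs = (if success (n - 1) then n + 1 else n),
       pstate = (\<lambda>k. if k = n \<or> success k then fom_init (F (eps k)) (it j) else new k),
       refpt = (\<lambda>k. if k = n \<or> success k then it j else refpt A k),
       xbar = it j\<rparr>"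
    have "scheme_round f F eps A B"
      unfolding scheme_round_def Let_def
      using j by (auto simp: B_def success_def n_def new_def it_def)
    moreover have "0 < nprocs B"
      using n by (simp add: B_def n_def)
    ultimately show ?thesis by blast
  qed
  obtain A where A: "0 < nprocs A" "scheme_init F eps N0 x0 A"
    using start by blast
  have "\<exists>R. R 0 = A \<and> (\<forall>t. 0 < nprocs (R t) \<and> scheme_round f F eps (R t) (R (Suc t)))"
  proof -
    have "\<exists>R. \<forall>t. (0 < nprocs (R t) \<and> (t = 0 \<longrightarrow> R t = A)) \<and> scheme_round f F eps (R t) (R (Suc t))"
      by (rule dependent_nat_choice) (use A next_round in auto)
    then show ?thesis by blast
  qed
  then show ?thesis
    using A by (auto simp: scheme_run_def)
qed

definition eps_optimal :: "'v set \<Rightarrow> ('v \<Rightarrow> real) \<Rightarrow> real \<Rightarrow> 'v \<Rightarrow> bool" where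
  "eps_optimal S f \<epsilon> x \<longleftrightarrow> x \<in> S \<and> f x - min_value S f \<le> \<epsilon>"

definition iteration_complexity ::
  "'v set \<Rightarrow> ('v \<Rightarrow> real) \<Rightarrow> real \<Rightarrow> (nat \<Rightarrow> ('v, 's) config) \<Rightarrow> nat"
where
  "iteration_complexity S f \<epsilon> R = (LEAST t. eps_optimal S f \<epsilon> (xbar (R t)))"

text \<open>In round \<open>Suc t\<close> each of the processes present in \<open>R t\<close> performs one iteration.\<close>

definition oracle_complexity ::
  "'v set \<Rightarrow> ('v \<Rightarrow> real) \<Rightarrow> real \<Rightarrow> (nat \<Rightarrow> ('v, 's) config) \<Rightarrow> nat"
where
  "oracle_complexity S f \<epsilon> R = (\<Sum>t<iteration_complexity S f \<epsilon> R. nprocs (R t))"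

text \<open>With \<open>sched \<epsilon>\<close> as targets, a single initial process and the accelerated scheme, every
  run reaches an epsilon-optimal point, and the complexities are at most of the order of
  \<open>rit\<close> and \<open>ror\<close> as epsilon tends to 0. The constant depends on \<open>p\<close> and \<open>sched\<close> only, and
  the range of epsilon on which the bounds hold depends in addition on \<open>L\<close>, \<open>\<mu>\<close>, \<open>\<Delta>0\<close>
  only. Both are uniform in the dimension, the objective, the initial point and the
  tie-breaking. The arguments of the rates are \<open>L\<close>, \<open>\<mu>\<close>, \<open>\<Delta>0\<close> and epsilon.\<close>

definition complexity_bounds ::
  "real \<Rightarrow> (real \<Rightarrow> nat \<Rightarrow> real) \<Rightarrow> (real \<Rightarrow> real \<Rightarrow> real \<Rightarrow> real \<Rightarrow> real) \<Rightarrow>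
   (real \<Rightarrow> real \<Rightarrow> real \<Rightarrow> real \<Rightarrow> real) \<Rightarrow> bool"
where
  "complexity_bounds p sched rit ror \<longleftrightarrow>
     (\<forall>L \<mu> \<Delta>0 \<epsilon> d f g x0 R.
        0 < L \<longrightarrow> 0 < \<mu> \<longrightarrow> 0 < \<epsilon> \<longrightarrow> \<epsilon> < \<Delta>0 \<longrightarrow>
        problem p L \<mu> \<Delta>0 d f g x0 \<longrightarrow>
        scheme_run f (\<lambda>_. accelerated L g) (sched \<epsilon>) 1 x0 R \<longrightarrow>
        (\<exists>t. eps_optimal (Rspace d) f \<epsilon> (xbar (R t)))) \<and>
     (\<exists>C>0. \<forall>L>0. \<forall>\<mu>>0. \<forall>\<Delta>0>0. \<forall>\<^sub>F \<epsilon> in at_right 0.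
        \<forall>d f g x0 R.
          problem p L \<mu> \<Delta>0 d f g x0 \<longrightarrow>
          scheme_run f (\<lambda>_. accelerated L g) (sched \<epsilon>) 1 x0 R \<longrightarrow>
          real (iteration_complexity (Rspace d) f \<epsilon> R) \<le> C * rit L \<mu> \<Delta>0 \<epsilon> \<and>
          real (oracle_complexity (Rspace d) f \<epsilon> R) \<le> C * ror L \<mu> \<Delta>0 \<epsilon>)"

section \<open>Optimality of the targets in the bound\<close>

definition admissible_targets :: "real \<Rightarrow> (nat \<Rightarrow> real) set" where
  "admissible_targets \<epsilon> =
     {e. strict_mono e \<and> (\<forall>k. 0 < e k) \<and> e 0 \<le> \<epsilon> / 2 \<and> filterlim e at_top sequentially}"

definition K_dec :: "real \<Rightarrow> real \<Rightarrow> real \<Rightarrow> real \<Rightarrow> real" where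
  "K_dec L \<epsilon> \<delta> D = sqrt (2 * L * D\<^sup>2 / (\<delta> - \<epsilon>))"

definition m_index :: "real \<Rightarrow> (nat \<Rightarrow> real) \<Rightarrow> nat" where
  "m_index \<Delta>0 e = Inf {k. e k \<ge> \<Delta>0 / 2}"

definition mhat_index :: "real \<Rightarrow> (nat \<Rightarrow> real) \<Rightarrow> nat" where
  "mhat_index \<Delta>0 e = Inf {k. e k > \<Delta>0}"

definition B_bound :: "real \<Rightarrow> real \<Rightarrow> real \<Rightarrow> real \<Rightarrow> (nat \<Rightarrow> real) \<Rightarrow> real" where
  "B_bound p L \<mu> \<Delta>0 e =
     (\<Sum>k<m_index \<Delta>0 e. (1 + 2 * e (Suc k) / e k) *
        K_dec L (e k) (2 * e k) ((2 * e k / \<mu>) powr (1 / p)))"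

definition no_better_targets ::
  "real \<Rightarrow> (real \<Rightarrow> real \<Rightarrow> real \<Rightarrow> real \<Rightarrow> real) \<Rightarrow>
   (real \<Rightarrow> real \<Rightarrow> real \<Rightarrow> real \<Rightarrow> real) \<Rightarrow> bool"
where
  "no_better_targets p rit ror \<longleftrightarrow>
     (\<exists>C>0. \<forall>L>0. \<forall>\<mu>>0. \<forall>\<Delta>0>0. \<forall>\<^sub>F \<epsilon> in at_right 0.
        (INF e\<in>admissible_targets \<epsilon>. B_bound p L \<mu> \<Delta>0 e) \<ge> C * rit L \<mu> \<Delta>0 \<epsilon> \<and>
        (INF e\<in>admissible_targets \<epsilon>. (real (mhat_index \<Delta>0 e) + 1) * B_bound p L \<mu> \<Delta>0 e)
          \<ge> C * ror L \<mu> \<Delta>0 \<epsilon>)"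

text \<open>These infima are neither over an empty set nor unbounded below.\<close>

lemma admissible_targets_nonempty:
  assumes "0 < \<epsilon>"
  shows "admissible_targets \<epsilon> \<noteq> {}"
proof -
  have "filterlim (\<lambda>k. \<epsilon> / 2 * (real k + 1)) at_top sequentially"
    using assms filterlim_tendsto_add_at_top[OF tendsto_const[of 1] filterlim_real_sequentially]
    by (intro filterlim_tendsto_pos_mult_at_top[OF tendsto_const]) (simp_all add: add.commute)
  then have "(\<lambda>k. \<epsilon> / 2 * (real k + 1)) \<in> admissible_targets \<epsilon>"
    using assms by (auto simp: admissible_targets_def strict_mono_def)
  then show ?thesis by blast
qed

lemma B_bound_nonneg:
  assumes "0 < L" "\<And>k. 0 < e k"
  shows "0 \<le> B_bound p L \<mu> \<Delta>0 e"
  unfolding B_bound_def K_dec_def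
  by (intro sum_nonneg mult_nonneg_nonneg) (use assms in \<open>auto simp: less_imp_le\<close>)

end

theory Submission
  imports Defs "HOL-Real_Asymp.Real_Asymp"
begin

text \<open>A process with target \<open>\<epsilon>\<^sub>k\<close> whose reference point has gap above \<open>2 \<epsilon>\<^sub>k\<close> succeeds within
  \<open>K\<^sub>k = \<lceil>K_dec\<rceil>\<close> rounds, by the rate of the accelerated method and the growth condition. So
  \<open>\<Sum>K\<^sub>k\<close> rounds suffice to launch the processes up to the first one whose reference gap is at most
  \<open>2 \<epsilon>\<^sub>k\<close>. At that moment the reference gap of the process below it is at most
  \<open>2 \<epsilon>\<^sub>k + \<epsilon>\<^sub>k\<^sub>-\<^sub>1\<close>, and each of its restarts lowers that gap by \<open>\<epsilon>\<^sub>k\<^sub>-\<^sub>1\<close>; cascading down to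
  process 0 gives the bound \<open>B\<close> up to a constant. Rounding \<open>K_dec\<close> up costs only a factor 2, since
  smoothness and growth together force \<open>K_dec \<ge> 1\<close> for the targets involved.

  For the lower bounds with \<open>p > 2\<close>, if \<open>B\<close> is below the oracle rate then
  \<open>\<epsilon>\<^sub>k\<^sub>+\<^sub>1 / \<epsilon> \<le> W (\<epsilon>\<^sub>k / \<epsilon>)\<^sup>1\<^sup>+\<^sup>\<alpha>\<close> with \<open>\<alpha> = 1/2 - 1/p\<close> and \<open>W = log log (\<Delta>\<^sub>0 / \<epsilon>)\<close>, so
  reaching \<open>\<Delta>\<^sub>0\<close> takes \<open>\<Omega>(W)\<close> targets. For \<open>p = 2\<close> apply Cauchy-Schwarz to the logarithms of
  the ratios \<open>\<epsilon>\<^sub>k\<^sub>+\<^sub>1 / \<epsilon>\<^sub>k\<close>.\<close>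

section \<open>The accelerated method\<close>

lemma gradient_along_line:
  assumes "subspace S" "is_gradient S f g" "x \<in> S" "h \<in> S"
  shows "((\<lambda>t. f (x + t *\<^sub>R h)) has_real_derivative inner (g (x + t *\<^sub>R h)) h) (at t)"
proof -
  \<comment> \<open>The whole line stays in the subspace, so a derivative within \<open>S\<close>
    becomes a two-sided derivative in \<open>t\<close>.\<close>
  have S: "x + s *\<^sub>R h \<in> S" for s
    using assms by (simp add: subspace_add subspace_scale)
  have "((\<lambda>s. f (x + s *\<^sub>R h)) has_derivative (\<lambda>s. inner (g (x + t *\<^sub>R h)) (s *\<^sub>R h))) (at t)"
  proof (rule has_derivative_in_compose2[where g = f and f = "\<lambda>s. x + s *\<^sub>R h" and t = S
        and g' = "\<lambda>y. inner (g y)"])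
    show "(f has_derivative inner (g y)) (at y within S)" if "y \<in> S" for y
      using assms(2) that by (simp add: is_gradient_def)
    show "((\<lambda>s. x + s *\<^sub>R h) has_derivative (\<lambda>s. s *\<^sub>R h)) (at t)"
      by (auto intro!: derivative_eq_intros)
  qed (use S in auto)
  then show ?thesis
    by (rule has_derivative_imp_has_field_derivative) (simp add: mult.commute)
qed

text \<open>Subtract the right-hand side from \<open>f\<close> along the segment from
  \<open>x\<close> to \<open>y\<close>. By Cauchy-Schwarz and the Lipschitz bound on
  \<open>g\<close>, the derivative of the difference \<open>\<phi>\<close> is nonpositive on
  [0, 1].\<close>

lemma smooth_upper_bound:
  assumes S: "subspace S" and grad: "is_gradient S f g" and lip: "L-lipschitz_on S g"
    and x: "x \<in> S" and y: "y \<in> S"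
  shows "f y \<le> f x + inner (g x) (y - x) + L / 2 * (norm (y - x))\<^sup>2"
proof -
  define h where "h = y - x"
  have h: "h \<in> S" using S x y by (simp add: h_def subspace_diff)
  define \<phi> where "\<phi> = (\<lambda>t. f (x + t *\<^sub>R h) - t * inner (g x) h - L / 2 * t\<^sup>2 * (norm h)\<^sup>2)"
  have "\<phi> 1 \<le> \<phi> 0"
  proof (rule DERIV_nonpos_imp_nonincreasing, simp)
    fix t :: real assume t: "0 \<le> t" "t \<le> 1"
    have d: "(\<phi> has_real_derivative (inner (g (x + t *\<^sub>R h)) h - inner (g x) h - L * t * (norm h)\<^sup>2)) (at t)"
      unfolding \<phi>_def
      by (auto intro!: derivative_eq_intros gradient_along_line[OF S grad x h])
    have "x + t *\<^sub>R h \<in> S"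
      using S x h by (simp add: subspace_add subspace_scale)
    then have "dist (g (x + t *\<^sub>R h)) (g x) \<le> L * dist (x + t *\<^sub>R h) x"
      using lip x by (auto simp: lipschitz_on_def)
    then have n: "norm (g (x + t *\<^sub>R h) - g x) \<le> L * (t * norm h)"
      using t by (simp add: dist_norm)
    have "inner (g (x + t *\<^sub>R h) - g x) h \<le> norm (g (x + t *\<^sub>R h) - g x) * norm h"
      by (rule norm_cauchy_schwarz)
    also have "\<dots> \<le> L * (t * norm h) * norm h"
      by (rule mult_right_mono[OF n]) simp
    finally have "inner (g (x + t *\<^sub>R h)) h - inner (g x) h - L * t * (norm h)\<^sup>2 \<le> 0"
      by (simp add: inner_diff_left power2_eq_square algebra_simps)
    with d show "\<exists>D. DERIV \<phi> t :> D \<and> D \<le> 0" by blast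
  qed
  then show ?thesis by (simp add: \<phi>_def h_def)
qed

lemma convex_above_tangent:
  assumes S: "subspace S" and conv: "convex_on S f" and grad: "is_gradient S f g"
    and x: "x \<in> S" and y: "y \<in> S"
  shows "f x + inner (g x) (y - x) \<le> f y"
proof -
  have h: "y - x \<in> S" using S x y by (simp add: subspace_diff)
  define \<phi> where "\<phi> = (\<lambda>t. f (x + t *\<^sub>R (y - x)))"
  have line: "x + t *\<^sub>R (y - x) \<in> S" for t
    using S x h by (simp add: subspace_add subspace_scale)
  have "convex_on UNIV \<phi>"
  proof (rule convex_onI)
    fix t a b :: real assume t: "0 < t" "t < 1"
    have "x + ((1 - t) *\<^sub>R a + t *\<^sub>R b) *\<^sub>R (y - x)
        = (1 - t) *\<^sub>R (x + a *\<^sub>R (y - x)) + t *\<^sub>R (x + b *\<^sub>R (y - x))"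
      by (simp add: algebra_simps)
    then show "\<phi> ((1 - t) *\<^sub>R a + t *\<^sub>R b) \<le> (1 - t) * \<phi> a + t * \<phi> b"
      unfolding \<phi>_def using convex_onD[OF conv, of t] t line by simp
  qed simp
  moreover have "(\<phi> has_real_derivative inner (g x) (y - x)) (at 0)"
    using gradient_along_line[OF S grad x h, of 0] by (simp add: \<phi>_def)
  ultimately have "\<phi> 1 - \<phi> 0 \<ge> inner (g x) (y - x) * (1 - 0)"
    by (intro convex_on_imp_above_tangent[where A = UNIV]) auto
  then show ?thesis by (simp add: \<phi>_def)
qed

text \<open>Adds the decrease of a gradient step at \<open>y\<close> to the tangent inequality at
  \<open>y\<close>. The potential argument uses it twice, with the current iterate and with the
  comparison point \<open>z\<close>.\<close>

lemma gradient_step_bound: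
  assumes S: "subspace S" and conv: "convex_on S f" and grad: "is_gradient S f g"
    and lip: "L-lipschitz_on S g" and L: "0 < L" and y: "y \<in> S" and z: "z \<in> S"
  shows "f (y - (1 / L) *\<^sub>R g y) \<le> f z + inner (g y) (y - z) - (norm (g y))\<^sup>2 / (2 * L)"
proof -
  have gy: "g y \<in> S" using grad y by (simp add: is_gradient_def)
  then have "y - (1 / L) *\<^sub>R g y \<in> S" using S y by (simp add: subspace_diff subspace_scale)
  from smooth_upper_bound[OF S grad lip y this]
  have "f (y - (1 / L) *\<^sub>R g y) \<le> f y - (1 / L) * (norm (g y))\<^sup>2 + L / 2 * ((1 / L) * norm (g y))\<^sup>2"
    using L by (simp add: dot_square_norm power_mult_distrib power_divide)
  also have "\<dots> = f y - (norm (g y))\<^sup>2 / (2 * L)"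
    using L by (simp add: field_simps power2_eq_square)
  also have "f y \<le> f z + inner (g y) (y - z)"
    using convex_above_tangent[OF S conv grad y z] by (simp add: inner_diff_right)
  finally show ?thesis by simp
qed

text \<open>Since \<open>\<theta>\<^sup>2 - \<theta>\<close> is the square of the previous theta \<open>\<theta>'\<close>, and \<open>x + \<theta> (y - x)\<close> equals
  \<open>\<theta>' x - (\<theta>' - 1) x'\<close> with the previous iterate \<open>x'\<close>, this is the Lyapunov function of
  Beck and Teboulle, expressed in the current state only.\<close>

definition accel_potential ::
  "real \<Rightarrow> ('v::real_inner \<Rightarrow> real) \<Rightarrow> 'v \<Rightarrow> 'v \<times> 'v \<times> real \<Rightarrow> real" where
  "accel_potential L f z = (\<lambda>(x, y, \<theta>).
     (\<theta>\<^sup>2 - \<theta>) * (f x - f z) + L / 2 * (norm (x + \<theta> *\<^sub>R (y - x) - z))\<^sup>2)"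

text \<open>The new theta is the positive root of the quadratic in the first claim, which makes the
  potential telescope. The second claim gives theta its linear growth, hence the quadratic
  rate.\<close>

lemma accel_theta_step:
  fixes \<theta> :: real
  assumes "1 \<le> \<theta>"
  defines "\<theta>' \<equiv> (1 + sqrt (1 + 4 * \<theta>\<^sup>2)) / 2"
  shows "\<theta>'\<^sup>2 - \<theta>' = \<theta>\<^sup>2" "\<theta> + 1 / 2 \<le> \<theta>'"
proof -
  have "(sqrt (1 + 4 * \<theta>\<^sup>2))\<^sup>2 = 1 + 4 * \<theta>\<^sup>2" by (simp add: add_nonneg_nonneg)
  then show "\<theta>'\<^sup>2 - \<theta>' = \<theta>\<^sup>2" by (simp add: \<theta>'_def power2_eq_square field_simps)
  have "2 * \<theta> \<le> sqrt (1 + 4 * \<theta>\<^sup>2)" by (rule real_le_rsqrt) (simp add: power2_eq_square)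
  then show "\<theta> + 1 / 2 \<le> \<theta>'" by (simp add: \<theta>'_def)
qed

text \<open>Take \<open>gradient_step_bound\<close> at \<open>x\<close> with weight
  \<open>\<theta> * (\<theta> - 1)\<close> and at \<open>z\<close> with weight
  \<open>\<theta>\<close>. The weights sum to \<open>\<theta>\<^sup>2\<close>, so the squared
  gradient norms cancel those from the expanded distance term, and the inner products combine to
  \<open>inner (g y) v\<close>.\<close>

lemma accel_potential_step:
  assumes S: "subspace S" and conv: "convex_on S f" and grad: "is_gradient S f g"
    and lip: "L-lipschitz_on S g" and L: "0 < L" and z: "z \<in> S"
    and x: "x \<in> S" and y: "y \<in> S" and \<theta>: "1 \<le> \<theta>"
  shows "accel_potential L f z (fom_step (accelerated L g) (x, y, \<theta>)) \<le> accel_potential L f z (x, y, \<theta>)"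
proof -
  define x' where "x' = y - (1 / L) *\<^sub>R g y"
  define \<theta>' where "\<theta>' = (1 + sqrt (1 + 4 * \<theta>\<^sup>2)) / 2"
  define v where "v = x + \<theta> *\<^sub>R (y - x) - z"
  have \<theta>': "\<theta>'\<^sup>2 - \<theta>' = \<theta>\<^sup>2" "\<theta>' \<noteq> 0"
    using accel_theta_step[OF \<theta>] \<theta> by (auto simp: \<theta>'_def[symmetric])
  have step: "fom_step (accelerated L g) (x, y, \<theta>) = (x', x' + ((\<theta> - 1) / \<theta>') *\<^sub>R (x' - x), \<theta>')"
    by (simp add: accelerated_def Let_def x'_def \<theta>'_def)
  \<comment> \<open>The momentum coefficient is chosen so that the extrapolated point moves by a
    multiple of the gradient only.\<close>
  have "x' + \<theta>' *\<^sub>R (((\<theta> - 1) / \<theta>') *\<^sub>R (x' - x)) - z = v - (\<theta> / L) *\<^sub>R g y"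
  proof -
    have "\<theta>' *\<^sub>R (((\<theta> - 1) / \<theta>') *\<^sub>R (x' - x)) = (\<theta> - 1) *\<^sub>R (x' - x)"
      using \<theta>' by simp
    then show ?thesis unfolding x'_def v_def by (simp only:) (simp add: algebra_simps diff_divide_distrib)
  qed
  then have "accel_potential L f z (fom_step (accelerated L g) (x, y, \<theta>))
      = \<theta>\<^sup>2 * (f x' - f z) + L / 2 * (norm (v - (\<theta> / L) *\<^sub>R g y))\<^sup>2"
    using \<theta>' by (simp add: step accel_potential_def)
  also have "(norm (v - (\<theta> / L) *\<^sub>R g y))\<^sup>2
      = (norm v)\<^sup>2 - 2 * (\<theta> / L) * inner (g y) v + (\<theta> / L)\<^sup>2 * (norm (g y))\<^sup>2"
    unfolding power2_norm_eq_inner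
    by (simp add: inner_diff_left inner_diff_right inner_commute algebra_simps power2_eq_square)
  also have "L / 2 * \<dots> = L / 2 * (norm v)\<^sup>2 - \<theta> * inner (g y) v + \<theta>\<^sup>2 * (norm (g y))\<^sup>2 / (2 * L)"
    using L by (simp add: field_simps power2_eq_square)
  finally have new: "accel_potential L f z (fom_step (accelerated L g) (x, y, \<theta>))
      = \<theta>\<^sup>2 * (f x' - f z) + (L / 2 * (norm v)\<^sup>2 - \<theta> * inner (g y) v + \<theta>\<^sup>2 * (norm (g y))\<^sup>2 / (2 * L))" .
  have "\<theta> * (\<theta> - 1) * f x' \<le> \<theta> * (\<theta> - 1) * (f x + inner (g y) (y - x) - (norm (g y))\<^sup>2 / (2 * L))"
    using gradient_step_bound[OF S conv grad lip L y x] \<theta>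
    by (intro mult_left_mono) (auto simp: x'_def)
  moreover have "\<theta> * f x' \<le> \<theta> * (f z + inner (g y) (y - z) - (norm (g y))\<^sup>2 / (2 * L))"
    using gradient_step_bound[OF S conv grad lip L y z] \<theta>
    by (intro mult_left_mono) (auto simp: x'_def)
  ultimately have "\<theta>\<^sup>2 * f x' \<le> \<theta> * (\<theta> - 1) * f x + \<theta> * f z
      + \<theta> * ((\<theta> - 1) * inner (g y) (y - x) + inner (g y) (y - z)) - \<theta>\<^sup>2 * (norm (g y))\<^sup>2 / (2 * L)"
    by (simp add: algebra_simps power2_eq_square add_divide_distrib diff_divide_distrib)
  moreover have "(\<theta> - 1) * inner (g y) (y - x) + inner (g y) (y - z) = inner (g y) v"
    by (simp add: v_def inner_diff_right inner_add_right algebra_simps)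
  ultimately have "\<theta>\<^sup>2 * f x' \<le> \<theta> * (\<theta> - 1) * f x + \<theta> * f z
      + \<theta> * inner (g y) v - \<theta>\<^sup>2 * (norm (g y))\<^sup>2 / (2 * L)"
    by (simp only:)
  moreover have "accel_potential L f z (x, y, \<theta>) = (\<theta>\<^sup>2 - \<theta>) * (f x - f z) + L / 2 * (norm v)\<^sup>2"
    by (simp add: accel_potential_def v_def)
  ultimately show ?thesis
    unfolding new by (simp add: algebra_simps power2_eq_square)
qed

text \<open>Initially \<open>\<theta>\<^sup>2 - \<theta>\<close> is 0, so the potential starts as
  the distance term alone; afterwards it never increases.\<close>

lemma accelerated_invariant:
  assumes S: "subspace S" and conv: "convex_on S f" and grad: "is_gradient S f g"
    and lip: "L-lipschitz_on S g" and L: "0 < L" and z: "z \<in> S" and x0: "x0 \<in> S"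
    and run: "(fom_step (accelerated L g) ^^ j) (fom_init (accelerated L g) x0) = (x, y, \<theta>)"
  shows "x \<in> S \<and> y \<in> S \<and> 1 + real j / 2 \<le> \<theta>
    \<and> accel_potential L f z (x, y, \<theta>) \<le> L / 2 * (norm (x0 - z))\<^sup>2"
  using run
proof (induction j arbitrary: x y \<theta>)
  case 0
  then show ?case using x0 by (auto simp: accelerated_def accel_potential_def)
next
  case (Suc j)
  obtain x1 y1 \<theta>1 where
    s1: "(fom_step (accelerated L g) ^^ j) (fom_init (accelerated L g) x0) = (x1, y1, \<theta>1)"
    using prod_cases3 by blast
  note IH = Suc.IH[OF this]
  have \<theta>1: "1 \<le> \<theta>1" using IH by auto
  have step: "fom_step (accelerated L g) (x1, y1, \<theta>1) = (x, y, \<theta>)"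
    using Suc.prems s1 by simp
  have "g y1 \<in> S" using grad IH by (simp add: is_gradient_def)
  then have "x \<in> S \<and> y \<in> S"
    using step IH S
    by (auto simp: accelerated_def Let_def intro!: subspace_add subspace_diff subspace_scale)
  moreover have "1 + real (Suc j) / 2 \<le> \<theta>"
    using step IH accel_theta_step(2)[OF \<theta>1] unfolding accelerated_def by (simp add: Let_def) argo
  moreover have "accel_potential L f z (x, y, \<theta>) \<le> L / 2 * (norm (x0 - z))\<^sup>2"
    using accel_potential_step[OF S conv grad lip L z, of x1 y1 \<theta>1] IH \<theta>1 step by auto
  ultimately show ?case by blast
qed

lemma accelerated_iterate_in:
  assumes "subspace S" "convex_on S f" "is_gradient S f g" "L-lipschitz_on S g" "0 < L" "x0 \<in> S"
  shows "fom_iterate (accelerated L g) ((fom_step (accelerated L g) ^^ j) (fom_init (accelerated L g) x0)) \<in> S"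
proof -
  obtain x y \<theta> where
    s: "(fom_step (accelerated L g) ^^ j) (fom_init (accelerated L g) x0) = (x, y, \<theta>)"
    using prod_cases3 by blast
  then have "x \<in> S" using accelerated_invariant assms by blast
  then show ?thesis by (simp add: s) (simp add: accelerated_def)
qed

lemma accelerated_rate:
  assumes S: "subspace S" and conv: "convex_on S f" and grad: "is_gradient S f g"
    and lip: "L-lipschitz_on S g" and L: "0 < L" and z: "z \<in> minimizers S f" and x0: "x0 \<in> S"
    and j: "0 < j"
  shows "f (fom_iterate (accelerated L g)
            ((fom_step (accelerated L g) ^^ j) (fom_init (accelerated L g) x0))) - f z
         \<le> 2 * L * (dist x0 z)\<^sup>2 / (real j)\<^sup>2"
proof -
  obtain x y \<theta> where
    s: "(fom_step (accelerated L g) ^^ j) (fom_init (accelerated L g) x0) = (x, y, \<theta>)"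
    using prod_cases3 by blast
  have zS: "z \<in> S" and min: "\<And>y. y \<in> S \<Longrightarrow> f z \<le> f y"
    using z by (auto simp: minimizers_def is_arg_min_linorder)
  note inv = accelerated_invariant[OF S conv grad lip L zS x0 s]
  \<comment> \<open>From \<open>\<theta> \<ge> 1 + j / 2\<close>, both factors on the right are at
    least \<open>j / 2\<close>.\<close>
  have "(real j / 2) * (real j / 2) \<le> \<theta> * (\<theta> - 1)"
    using inv by (intro mult_mono) auto
  then have "(real j)\<^sup>2 / 4 * (f x - f z) \<le> (\<theta>\<^sup>2 - \<theta>) * (f x - f z)"
    using inv min[of x] by (intro mult_right_mono) (auto simp: power2_eq_square algebra_simps)
  also have "\<dots> \<le> L / 2 * (norm (x0 - z))\<^sup>2"
  proof -
    have "0 \<le> L / 2 * (norm (x + \<theta> *\<^sub>R (y - x) - z))\<^sup>2" using L by simp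
    then show ?thesis using inv by (simp add: accel_potential_def)
  qed
  finally have "f x - f z \<le> 2 * L * (dist x0 z)\<^sup>2 / (real j)\<^sup>2"
    using j by (simp add: field_simps dist_norm)
  then show ?thesis by (simp add: s) (simp add: accelerated_def)
qed

section \<open>The restarting scheme for an abstract first-order method\<close>

text \<open>\<open>K k\<close> is the number of iterations after which process \<open>k\<close> must
  have succeeded while its reference gap exceeds \<open>2 * eps k\<close>. The assumption
  \<open>progress\<close> covers all \<open>j \<ge> K k\<close> because, when the rounds start being
  counted, the process may already have run for some time.\<close>

locale restart_run =
  fixes S :: "'v set" and f :: "'v \<Rightarrow> real" and F :: "real \<Rightarrow> ('v, 's) fom"
    and eps :: "nat \<Rightarrow> real" and x0 :: 'v and R :: "nat \<Rightarrow> ('v, 's) config"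
    and fs :: real and K :: "nat \<Rightarrow> nat"
  assumes run: "scheme_run f F eps 1 x0 R"
    and x0: "x0 \<in> S"
    and eps_pos: "\<And>k. 0 < eps k"
    and K_pos: "\<And>k. 0 < K k"
    and iterate_in: "\<And>x k j. x \<in> S \<Longrightarrow>
      fom_iterate (F (eps k)) ((fom_step (F (eps k)) ^^ j) (fom_init (F (eps k)) x)) \<in> S"
    and lower: "\<And>x. x \<in> S \<Longrightarrow> fs \<le> f x"
    and progress: "\<And>x k j. x \<in> S \<Longrightarrow> f x \<le> f x0 \<Longrightarrow> 2 * eps k < f x - fs \<Longrightarrow> K k \<le> j \<Longrightarrow>
      f (fom_iterate (F (eps k)) ((fom_step (F (eps k)) ^^ j) (fom_init (F (eps k)) x))) \<le> f x - eps k"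
begin

abbreviation success :: "nat \<Rightarrow> nat \<Rightarrow> bool" where
  "success t k \<equiv> f (xbar (R (Suc t))) \<le> f (refpt (R t) k) - eps k"

abbreviation gap :: "nat \<Rightarrow> nat \<Rightarrow> real" where
  "gap t k \<equiv> f (refpt (R t) k) - fs"

section \<open>The effect of one round\<close>

lemma initial:
  "nprocs (R 0) = 1" "xbar (R 0) = x0" "refpt (R 0) 0 = x0" "pstate (R 0) 0 = fom_init (F (eps 0)) x0"
  using run by (auto simp: scheme_run_def scheme_init_def)

lemma round: "scheme_round f F eps (R t) (R (Suc t))"
  using run by (simp add: scheme_run_def)

lemma nprocs_Suc:
  "nprocs (R (Suc t)) = (if success t (nprocs (R t) - 1) then nprocs (R t) + 1 else nprocs (R t))"
  using round[of t] by (simp add: scheme_round_def Let_def split: if_splits)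

lemma xbar_Suc:
  obtains j where "j < nprocs (R t)"
    "xbar (R (Suc t)) = fom_iterate (F (eps j)) (fom_step (F (eps j)) (pstate (R t) j))"
  using round[of t] by (auto simp: scheme_round_def Let_def)

lemma xbar_Suc_le:
  assumes "k < nprocs (R t)"
  shows "f (xbar (R (Suc t))) \<le> f (fom_iterate (F (eps k)) (fom_step (F (eps k)) (pstate (R t) k)))"
  using round[of t] assms by (auto simp: scheme_round_def Let_def)

lemma restarted:
  assumes "k < nprocs (R t)" "success t k"
  shows "pstate (R (Suc t)) k = fom_init (F (eps k)) (xbar (R (Suc t)))"
    "refpt (R (Suc t)) k = xbar (R (Suc t))"
  using round[of t] assms by (auto simp: scheme_round_def Let_def)

lemma continued:
  assumes "k < nprocs (R t)" "\<not> success t k"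
  shows "pstate (R (Suc t)) k = fom_step (F (eps k)) (pstate (R t) k)"
    "refpt (R (Suc t)) k = refpt (R t) k"
  using round[of t] assms by (auto simp: scheme_round_def Let_def)

lemma launched:
  assumes "success t (nprocs (R t) - 1)"
  shows "pstate (R (Suc t)) (nprocs (R t)) = fom_init (F (eps (nprocs (R t)))) (xbar (R (Suc t)))"
    "refpt (R (Suc t)) (nprocs (R t)) = xbar (R (Suc t))"
  using round[of t] assms by (auto simp: scheme_round_def Let_def)

lemma nprocs_pos: "0 < nprocs (R t)"
  by (induction t) (auto simp: initial nprocs_Suc)

lemma nprocs_mono: "s \<le> t \<Longrightarrow> nprocs (R s) \<le> nprocs (R t)"
  by (induction t rule: dec_induct) (auto simp: nprocs_Suc)

text \<open>Restart and launch are merged into one case. The index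
  \<open>min k (nprocs (R t) - 1)\<close> names the process whose success caused it:
  \<open>k\<close> itself for a restart, the highest one for a launch.\<close>

lemma process_cases [consumes 1, case_names new kept]:
  assumes "k < nprocs (R (Suc t))"
  obtains "success t (min k (nprocs (R t) - 1))"
      "pstate (R (Suc t)) k = fom_init (F (eps k)) (xbar (R (Suc t)))"
      "refpt (R (Suc t)) k = xbar (R (Suc t))"
  | "k < nprocs (R t)" "\<not> success t k"
      "pstate (R (Suc t)) k = fom_step (F (eps k)) (pstate (R t) k)"
      "refpt (R (Suc t)) k = refpt (R t) k"
proof (cases "k < nprocs (R t)")
  case True
  then have "min k (nprocs (R t) - 1) = k" by simp
  with True show ?thesis using restarted[of k t] continued[of k t] that by metis
next
  case False
  then have "success t (nprocs (R t) - 1)" "k = nprocs (R t)"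
    using assms nprocs_Suc[of t] by (auto split: if_splits)
  moreover from this have "min k (nprocs (R t) - 1) = nprocs (R t) - 1" by simp
  ultimately show ?thesis using launched[of t] that by metis
qed

section \<open>Invariants of reference points\<close>

text \<open>The last conjunct is what later turns a small reference gap into a good point actually
  output by the scheme.\<close>

lemma process_invariant:
  "xbar (R t) \<in> S \<and> (\<forall>k<nprocs (R t). refpt (R t) k \<in> S \<and> f (refpt (R t) k) \<le> f x0
     \<and> (\<exists>j. pstate (R t) k = (fom_step (F (eps k)) ^^ j) (fom_init (F (eps k)) (refpt (R t) k)))
     \<and> (\<exists>s\<le>t. refpt (R t) k = xbar (R s)))"
proof (induction t)
  case 0
  have "\<exists>j. pstate (R 0) 0 = (fom_step (F (eps 0)) ^^ j) (fom_init (F (eps 0)) x0)"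
    by (rule exI[of _ 0]) (simp add: initial)
  then show ?case using x0 by (auto simp: initial)
next
  case (Suc t)
  have "xbar (R (Suc t)) \<in> S"
  proof -
    obtain k where k: "k < nprocs (R t)"
      "xbar (R (Suc t)) = fom_iterate (F (eps k)) (fom_step (F (eps k)) (pstate (R t) k))"
      by (rule xbar_Suc)
    then obtain j where "pstate (R t) k = (fom_step (F (eps k)) ^^ j) (fom_init (F (eps k)) (refpt (R t) k))"
      using Suc by blast
    then have "xbar (R (Suc t))
        = fom_iterate (F (eps k)) ((fom_step (F (eps k)) ^^ Suc j) (fom_init (F (eps k)) (refpt (R t) k)))"
      using k by simp
    then show ?thesis using iterate_in Suc k by metis
  qed
  moreover have "refpt (R (Suc t)) k \<in> S \<and> f (refpt (R (Suc t)) k) \<le> f x0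
     \<and> (\<exists>j. pstate (R (Suc t)) k
            = (fom_step (F (eps k)) ^^ j) (fom_init (F (eps k)) (refpt (R (Suc t)) k)))
     \<and> (\<exists>s\<le>Suc t. refpt (R (Suc t)) k = xbar (R s))" if "k < nprocs (R (Suc t))" for k
    using that
  proof (cases rule: process_cases)
    case new
    have "min k (nprocs (R t) - 1) < nprocs (R t)" using nprocs_pos[of t] by auto
    then have "f (refpt (R t) (min k (nprocs (R t) - 1))) \<le> f x0" using Suc by blast
    then have "f (xbar (R (Suc t))) \<le> f x0"
      using new(1) eps_pos[of "min k (nprocs (R t) - 1)"] by linarith
    moreover have "\<exists>j. pstate (R (Suc t)) k
        = (fom_step (F (eps k)) ^^ j) (fom_init (F (eps k)) (refpt (R (Suc t)) k))"
      by (rule exI[of _ 0]) (simp add: new)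
    ultimately show ?thesis using new \<open>xbar (R (Suc t)) \<in> S\<close> by auto
  next
    case kept
    then obtain j where "pstate (R t) k = (fom_step (F (eps k)) ^^ j) (fom_init (F (eps k)) (refpt (R t) k))"
      using Suc by blast
    then have "pstate (R (Suc t)) k
        = (fom_step (F (eps k)) ^^ Suc j) (fom_init (F (eps k)) (refpt (R (Suc t)) k))"
      using kept by simp
    moreover have "\<exists>s\<le>Suc t. refpt (R (Suc t)) k = xbar (R s)" using Suc kept by (metis le_SucI)
    moreover have "refpt (R (Suc t)) k \<in> S \<and> f (refpt (R (Suc t)) k) \<le> f x0"
      using Suc kept by auto
    ultimately show ?thesis by blast
  qed
  ultimately show ?case by blast
qed

lemma refpt_Suc_le: "k < nprocs (R t) \<Longrightarrow> f (refpt (R (Suc t)) k) \<le> f (refpt (R t) k)"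
  using restarted[of k t] continued[of k t] eps_pos[of k] by (cases "success t k") auto

lemma refpt_antimono:
  assumes "k < nprocs (R s)" "s \<le> t"
  shows "f (refpt (R t) k) \<le> f (refpt (R s) k)"
  using assms(2)
proof (induction t rule: dec_induct)
  case (step t)
  then have "k < nprocs (R t)" using nprocs_mono[of s t] assms by simp
  then show ?case using step refpt_Suc_le by fastforce
qed simp

text \<open>When process \<open>i\<close> moves to the new best point, process \<open>j\<close>
  either moves there too or has failed, and failure says that this point is less than
  \<open>eps j\<close> below the reference of \<open>j\<close>. While \<open>i\<close> stays put,
  the reference value of \<open>j\<close> can only fall.\<close>

lemma refpt_ordered:
  "j < i \<Longrightarrow> i < nprocs (R t) \<Longrightarrow> f (refpt (R t) j) \<le> f (refpt (R t) i) + eps j"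
proof (induction t)
  case 0
  then show ?case by (simp add: initial)
next
  case (Suc t)
  have j: "j < nprocs (R t)"
    using Suc.prems nprocs_Suc[of t] by (auto split: if_splits)
  from Suc.prems(2) show ?case
  proof (cases rule: process_cases)
    case new
    then show ?thesis using restarted[of j t] continued[of j t] j eps_pos[of j]
      by (cases "success t j") auto
  next
    case kept
    then show ?thesis using Suc.IH Suc.prems refpt_Suc_le[OF j] by fastforce
  qed
qed

section \<open>Time until the target accuracy is reached\<close>

text \<open>Without a success in \<open>K k\<close> rounds the process runs uninterrupted, so
  \<open>progress\<close> applies to its last iterate, and the best point of that round is at least
  as good.\<close>

lemma success_within:
  assumes k: "k < nprocs (R t)" and big: "2 * eps k < gap t k"
  shows "\<exists>s\<ge>t. Suc s \<le> t + K k \<and> success s k"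
proof (rule ccontr)
  assume "\<not> ?thesis"
  then have fail: "\<not> success (t + i) k" if "i < K k" for i
    using that by (metis Suc_leI le_add1 nat_add_left_cancel_less)
  obtain j where j: "pstate (R t) k = (fom_step (F (eps k)) ^^ j) (fom_init (F (eps k)) (refpt (R t) k))"
    using process_invariant k by blast
  have state: "refpt (R (t + i)) k = refpt (R t) k \<and>
      pstate (R (t + i)) k = (fom_step (F (eps k)) ^^ (i + j)) (fom_init (F (eps k)) (refpt (R t) k))"
    if "i < K k" for i
    using that
  proof (induction i)
    case (Suc i)
    have "k < nprocs (R (t + i))" using nprocs_mono[of t "t + i"] k by simp
    then show ?case using continued[of k "t + i"] fail[of i] Suc by simp
  qed (simp add: j)
  \<comment> \<open>The state after round \<open>t + i\<close> still has its next step to come, so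
    round \<open>Suc (t + i)\<close> is the one that completes \<open>K k\<close> further
    iterations.\<close>
  define i where "i = K k - 1"
  have i: "i < K k" "Suc i = K k" using K_pos[of k] by (auto simp: i_def)
  have ki: "k < nprocs (R (t + i))" using nprocs_mono[of t "t + i"] k by simp
  have "f (xbar (R (Suc (t + i)))) \<le>
      f (fom_iterate (F (eps k)) ((fom_step (F (eps k)) ^^ Suc (i + j)) (fom_init (F (eps k)) (refpt (R t) k))))"
    using xbar_Suc_le[OF ki] state[OF i(1)] by simp
  also have "\<dots> \<le> f (refpt (R t) k) - eps k"
    by (rule progress) (use process_invariant[of t] k big i in auto)
  finally show False using fail[OF i(1)] state[OF i(1)] by simp
qed

text \<open>Each success lowers the gap by at least \<open>eps k\<close> and takes at most
  \<open>K k\<close> rounds, so \<open>n\<close> of them suffice.\<close>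

lemma gap_decreases:
  assumes "k < nprocs (R t)" "gap t k \<le> (real n + 2) * eps k"
  shows "\<exists>s\<ge>t. s \<le> t + n * K k \<and> gap s k \<le> 2 * eps k"
  using assms
proof (induction n arbitrary: t)
  case 0
  then show ?case by auto
next
  case (Suc n)
  show ?case
  proof (cases "gap t k \<le> 2 * eps k")
    case False
    then obtain s where s: "t \<le> s" "Suc s \<le> t + K k" "success s k"
      using success_within[OF Suc.prems(1)] by auto
    have ks: "k < nprocs (R s)" using nprocs_mono[OF s(1)] Suc.prems by simp
    have "f (refpt (R s) k) \<le> f (refpt (R t) k)"
      by (rule refpt_antimono[OF Suc.prems(1) s(1)])
    then have "gap (Suc s) k \<le> (real n + 2) * eps k"
      using restarted(2)[OF ks s(3)] s(3) Suc.prems(2) by (simp add: algebra_simps)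
    moreover have "k < nprocs (R (Suc s))" using nprocs_mono[of s "Suc s"] ks by simp
    ultimately obtain s' where "Suc s \<le> s'" "s' \<le> Suc s + n * K k" "gap s' k \<le> 2 * eps k"
      using Suc.IH by blast
    then show ?thesis using s by (intro exI[of _ s']) auto
  qed auto
qed

text \<open>Enough restarts to bring the gap of process \<open>k\<close> from
  \<open>2 * eps (Suc k) + eps k\<close> down to \<open>2 * eps k\<close>.\<close>

definition nrestarts :: "nat \<Rightarrow> nat" where
  "nrestarts k = nat \<lceil>2 * eps (Suc k) / eps k\<rceil>"

text \<open>Descends through the processes: \<open>refpt_ordered\<close> passes a small gap of
  process \<open>Suc j\<close> on to process \<open>j\<close> at the cost of \<open>eps j\<close>,
  and \<open>nrestarts j\<close> restarts remove the excess.\<close>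

lemma gap_cascade:
  assumes "j < nprocs (R t)" "gap t j \<le> 2 * eps j"
  shows "\<exists>s\<le>t + (\<Sum>i<j. nrestarts i * K i). gap s 0 \<le> 2 * eps 0"
  using assms
proof (induction j arbitrary: t)
  case 0
  then show ?case by auto
next
  case (Suc j)
  have j: "j < nprocs (R t)" using Suc.prems by simp
  have "gap t j \<le> 2 * eps (Suc j) + eps j"
    using refpt_ordered[of j "Suc j" t] Suc.prems by simp
  also have "2 * eps (Suc j) = 2 * eps (Suc j) / eps j * eps j" using eps_pos[of j] by simp
  also have "\<dots> + eps j \<le> real (nrestarts j) * eps j + 2 * eps j"
    using eps_pos[of j] of_nat_ceiling[of "2 * eps (Suc j) / eps j"]
    unfolding nrestarts_def by (intro add_mono mult_right_mono) auto
  finally have "gap t j \<le> (real (nrestarts j) + 2) * eps j" by (simp add: algebra_simps)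
  from gap_decreases[OF j this] obtain s where
    s: "t \<le> s" "s \<le> t + nrestarts j * K j" "gap s j \<le> 2 * eps j" by blast
  have "j < nprocs (R s)" using nprocs_mono[OF s(1)] j by simp
  from Suc.IH[OF this s(3)] obtain s' where
    "s' \<le> s + (\<Sum>i<j. nrestarts i * K i)" "gap s' 0 \<le> 2 * eps 0" by blast
  then show ?case using s(2) by (intro exI[of _ s']) simp
qed

text \<open>As long as no launched process has a small gap, the highest one needed so far succeeds
  within its \<open>K\<close> rounds and its successor is then present.\<close>

lemma launch_or_small_gap:
  "\<exists>t\<le>\<Sum>j<k. K j. k < nprocs (R t) \<or> (\<exists>j<k. j < nprocs (R t) \<and> gap t j \<le> 2 * eps j)"
proof (induction k)
  case 0
  then show ?case using nprocs_pos by auto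
next
  case (Suc k)
  then obtain t where t: "t \<le> (\<Sum>j<k. K j)"
    "k < nprocs (R t) \<or> (\<exists>j<k. j < nprocs (R t) \<and> gap t j \<le> 2 * eps j)" by blast
  show ?case
  proof (cases "\<exists>j<Suc k. j < nprocs (R t) \<and> gap t j \<le> 2 * eps j")
    case True
    then show ?thesis using t by (intro exI[of _ t]) auto
  next
    case False
    then have k: "k < nprocs (R t)" "2 * eps k < gap t k" using t by force+
    from success_within[OF this] obtain s where
      s: "t \<le> s" "Suc s \<le> t + K k" "success s k" by blast
    have "k < nprocs (R s)" using nprocs_mono[OF s(1)] k by simp
    then have "Suc k < nprocs (R (Suc s))"
      using s(3) nprocs_Suc[of s] by (cases "k = nprocs (R s) - 1") auto
    then show ?thesis using s t by (intro exI[of _ "Suc s"]) auto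
  qed
qed

lemma reaches_target:
  assumes "f x0 - fs \<le> 2 * eps m"
  shows "\<exists>t\<le>\<Sum>k<m. (1 + nrestarts k) * K k. xbar (R t) \<in> S \<and> f (xbar (R t)) - fs \<le> 2 * eps 0"
proof -
  obtain t where t: "t \<le> (\<Sum>k<m. K k)"
    "m < nprocs (R t) \<or> (\<exists>j<m. j < nprocs (R t) \<and> gap t j \<le> 2 * eps j)"
    using launch_or_small_gap by blast
  \<comment> \<open>Reference values never exceed \<open>f x0\<close>, so process \<open>m\<close>
    has a small gap as soon as it exists.\<close>
  have "m < nprocs (R t) \<Longrightarrow> gap t m \<le> 2 * eps m"
    using process_invariant[of t] assms by fastforce
  then obtain j where j: "j \<le> m" "j < nprocs (R t)" "gap t j \<le> 2 * eps j"
    using t(2) by (meson le_refl less_imp_le)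
  obtain s where s: "s \<le> t + (\<Sum>i<j. nrestarts i * K i)" "gap s 0 \<le> 2 * eps 0"
    using gap_cascade[OF j(2,3)] by blast
  have "(\<Sum>i<j. nrestarts i * K i) \<le> (\<Sum>i<m. nrestarts i * K i)"
    by (rule sum_mono2) (use j in auto)
  then have "s \<le> (\<Sum>k<m. (1 + nrestarts k) * K k)"
    using s t by (simp add: algebra_simps sum.distrib)
  moreover obtain s' where "s' \<le> s" "refpt (R s) 0 = xbar (R s')"
    using process_invariant[of s] nprocs_pos by blast
  ultimately show ?thesis using s(2) process_invariant[of s'] by (intro exI[of _ s']) auto
qed

text \<open>A success of process \<open>M\<close> would push the objective below \<open>fs\<close>,
  so process \<open>M + 1\<close> is never launched.\<close>

lemma nprocs_bound:
  assumes "f x0 - fs < eps M"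
  shows "nprocs (R t) \<le> Suc M"
proof (induction t)
  case 0
  then show ?case by (simp add: initial)
next
  case (Suc t)
  show ?case
  proof (rule ccontr)
    assume "\<not> nprocs (R (Suc t)) \<le> Suc M"
    then have "nprocs (R t) = Suc M" "success t (nprocs (R t) - 1)"
      using Suc nprocs_Suc[of t] by (auto split: if_splits)
    then have "f (xbar (R (Suc t))) \<le> f (refpt (R t) M) - eps M" by simp
    moreover have "f (refpt (R t) M) \<le> f x0"
      using process_invariant[of t] \<open>nprocs (R t) = Suc M\<close> by auto
    moreover have "fs \<le> f (xbar (R (Suc t)))"
      using process_invariant[of "Suc t"] lower by blast
    ultimately show False using assms by linarith
  qed
qed

end

section \<open>Complexity in terms of the bound B\<close>

lemma K_dec_doubling:
  assumes "0 < e" "0 < \<mu>" "0 < L"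
  shows "K_dec L e (2 * e) ((2 * e / \<mu>) powr (1 / p))
    = sqrt 2 * 2 powr (1 / p) * (sqrt L / \<mu> powr (1 / p)) * (1 / e powr (1 / 2 - 1 / p))"
proof -
  define D where "D = (2 * e / \<mu>) powr (1 / p)"
  have "K_dec L e (2 * e) D = sqrt 2 * sqrt L * D / e powr (1 / 2)"
    using assms by (simp add: K_dec_def real_sqrt_mult real_sqrt_divide powr_half_sqrt D_def)
  also have "\<dots> = sqrt 2 * 2 powr (1 / p) * (sqrt L / \<mu> powr (1 / p)) * (1 / e powr (1 / 2 - 1 / p))"
    using assms by (simp add: D_def powr_mult powr_divide powr_diff)
  finally show ?thesis by (simp add: D_def)
qed

lemma below_m_index: "k < m_index \<Delta>0 e \<Longrightarrow> e k < \<Delta>0 / 2"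
  unfolding m_index_def using cInf_lower[of k "{k. e k \<ge> \<Delta>0 / 2}"] by force

lemma eventually_ratio:
  assumes "eventually P at_top" "(0::real) < \<Delta>0"
  shows "\<forall>\<^sub>F \<epsilon> in at_right 0. P (\<Delta>0 / \<epsilon>)"
proof -
  have "filterlim (\<lambda>\<epsilon>. \<Delta>0 / \<epsilon>) at_top (at_right 0)" using assms(2) by real_asymp
  then show ?thesis using assms(1) by (simp add: filterlim_iff)
qed

locale growth_problem =
  fixes p L \<mu> \<Delta>0 :: real and d f g x0
  assumes prob: "problem p L \<mu> \<Delta>0 d f g x0" and p: "2 \<le> p" and L: "0 < L" and \<mu>: "0 < \<mu>" and \<Delta>0: "0 < \<Delta>0"
begin

abbreviation "S \<equiv> Rspace d"
abbreviation "fs \<equiv> min_value S f"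
abbreviation "Xs \<equiv> minimizers S f"

lemma convex: "convex_on S f" and gradient: "is_gradient S f g" and lipschitz: "L-lipschitz_on S g"
  and minimizers_nonempty: "Xs \<noteq> {}" and start: "x0 \<in> S" and initial_gap: "f x0 - fs = \<Delta>0"
  and growth: "x \<in> S \<Longrightarrow> f x \<le> f x0 \<Longrightarrow> \<mu> * infdist x Xs powr p \<le> f x - fs"
  using prob by (auto simp: problem_def)

lemma minimizer: "z \<in> Xs \<longleftrightarrow> z \<in> S \<and> (\<forall>x\<in>S. f z \<le> f x)"
  by (auto simp: minimizers_def is_arg_min_linorder)

lemma minimizer_value: "z \<in> Xs \<Longrightarrow> f z = fs"
  unfolding min_value_def by (rule cInf_eq_minimum[symmetric]) (auto simp: minimizer)

lemma min_value_le: "x \<in> S \<Longrightarrow> fs \<le> f x"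
  using minimizers_nonempty minimizer minimizer_value by (metis ex_in_conv)

text \<open>Takes the place of a projection onto \<open>Xs\<close>: an estimate valid for each
  minimizer passes to the infimum of the distances.\<close>

lemma infdist_greatest:
  assumes "\<And>z. z \<in> Xs \<Longrightarrow> b \<le> dist x z"
  shows "b \<le> infdist x Xs"
  using assms minimizers_nonempty by (simp add: infdist_notempty cINF_greatest)

lemma rate:
  assumes "x \<in> S" "0 < j"
  shows "f (fom_iterate (accelerated L g) ((fom_step (accelerated L g) ^^ j) (fom_init (accelerated L g) x)))
    - fs \<le> 2 * L * (infdist x Xs)\<^sup>2 / (real j)\<^sup>2" (is "?r \<le> _")
proof -
  have "sqrt (?r * (real j)\<^sup>2 / (2 * L)) \<le> infdist x Xs"
  proof (rule infdist_greatest)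
    fix z assume z: "z \<in> Xs"
    have "?r * (real j)\<^sup>2 / (2 * L) \<le> (dist x z)\<^sup>2"
      using accelerated_rate[OF subspace_Rspace convex gradient lipschitz L z assms] minimizer_value[OF z]
        L assms by (simp add: field_simps)
    then show "sqrt (?r * (real j)\<^sup>2 / (2 * L)) \<le> dist x z" by (rule real_le_lsqrt[rotated]) simp
  qed
  then have "?r * (real j)\<^sup>2 / (2 * L) \<le> (infdist x Xs)\<^sup>2" by (rule sqrt_le_D)
  then show ?thesis using L assms by (simp add: field_simps)
qed

lemma growth_radius:
  assumes "x \<in> S" "f x \<le> f x0"
  shows "infdist x Xs \<le> ((f x - fs) / \<mu>) powr (1 / p)"
proof -
  have "infdist x Xs powr p \<le> (f x - fs) / \<mu>"
    using growth[OF assms] \<mu> by (simp add: field_simps)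
  then have "(infdist x Xs powr p) powr (1 / p) \<le> ((f x - fs) / \<mu>) powr (1 / p)"
    using p by (intro powr_mono2) auto
  then show ?thesis using p infdist_nonneg[of x Xs] by (simp add: powr_powr)
qed

lemma smooth_gap:
  assumes z: "z \<in> Xs" and x: "x \<in> S"
  shows "f x - fs \<le> L / 2 * (dist x z)\<^sup>2"
proof -
  have zS: "z \<in> S" using z minimizer by simp
  then have "g z \<in> S" using gradient by (simp add: is_gradient_def)
  then have "z - (1 / L) *\<^sub>R g z \<in> S"
    using zS subspace_Rspace by (simp add: subspace_diff subspace_scale)
  \<comment> \<open>A gradient step from a minimizer cannot decrease \<open>f\<close>, which forces
    \<open>g z = 0\<close>.\<close>
  then have "f z \<le> f (z - (1 / L) *\<^sub>R g z)" using z minimizer by simp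
  also have "\<dots> \<le> f z - (norm (g z))\<^sup>2 / (2 * L)"
    using gradient_step_bound[OF subspace_Rspace convex gradient lipschitz L zS zS] by simp
  finally have "g z = 0" using L by (simp add: field_simps)
  then show ?thesis
    using smooth_upper_bound[OF subspace_Rspace gradient lipschitz zS x] minimizer_value[OF z]
    by (simp add: dist_norm)
qed

text \<open>Smoothness bounds the distance of \<open>x0\<close> from the minimizers from below,
  growth bounds it from above; comparing the two relates \<open>L\<close> and
  \<open>\<mu>\<close>.\<close>

lemma conditioning: "\<Delta>0 powr (1 / 2 - 1 / p) \<le> sqrt (L / 2) / \<mu> powr (1 / p)"
proof -
  have "sqrt (2 * \<Delta>0 / L) \<le> infdist x0 Xs"
  proof (rule infdist_greatest)
    fix z assume z: "z \<in> Xs"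
    show "sqrt (2 * \<Delta>0 / L) \<le> dist x0 z"
      using smooth_gap[OF z start] initial_gap L by (intro real_le_lsqrt) (auto simp: field_simps)
  qed
  also have "\<dots> \<le> (\<Delta>0 / \<mu>) powr (1 / p)" using growth_radius[OF start] initial_gap by simp
  finally have "sqrt 2 * sqrt \<Delta>0 / sqrt L \<le> \<Delta>0 powr (1 / p) / \<mu> powr (1 / p)"
    using \<Delta>0 \<mu> by (simp add: powr_divide real_sqrt_mult real_sqrt_divide)
  then have "sqrt \<Delta>0 / \<Delta>0 powr (1 / p) \<le> sqrt L / sqrt 2 / \<mu> powr (1 / p)"
    using \<Delta>0 \<mu> L by (simp add: field_simps)
  then show ?thesis using \<Delta>0 by (simp add: powr_diff powr_half_sqrt real_sqrt_divide)
qed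

section \<open>Iterations needed for one decrease by \<open>e\<close>\<close>

abbreviation "Kd e \<equiv> K_dec L e (2 * e) ((2 * e / \<mu>) powr (1 / p))"

lemma Kd_pos: "0 < e \<Longrightarrow> 0 < Kd e"
  using L \<mu> by (simp add: K_dec_doubling)

lemma progress:
  assumes x: "x \<in> S" "f x \<le> f x0" and e: "0 < e" "2 * e < f x - fs" and j: "nat \<lceil>Kd e\<rceil> \<le> j"
  shows "f (fom_iterate (accelerated L g) ((fom_step (accelerated L g) ^^ j) (fom_init (accelerated L g) x)))
    \<le> f x - e" (is "f ?x \<le> _")
proof -
  define G D where "G = f x - fs" and "D = infdist x Xs"
  have Kj: "Kd e \<le> real j" using j by linarith
  then have j0: "0 < j" using Kd_pos[OF e(1)] by auto
  have s: "1 \<le> G / (2 * e)" using e by (simp add: G_def)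
  have "D\<^sup>2 \<le> ((G / \<mu>) powr (1 / p))\<^sup>2"
    using growth_radius[OF x] by (intro power_mono) (auto simp: D_def G_def infdist_nonneg)
  also have "(G / \<mu>) powr (1 / p) = (2 * e / \<mu>) powr (1 / p) * (G / (2 * e)) powr (1 / p)"
    using e \<mu> by (simp add: G_def flip: powr_mult)
  also have "(\<dots>)\<^sup>2 = ((2 * e / \<mu>) powr (1 / p))\<^sup>2 * (G / (2 * e)) powr (2 / p)"
    by (simp add: power_mult_distrib power2_eq_square[of "(G / _) powr _"] flip: powr_add)
  \<comment> \<open>The base is at least 1 and \<open>2 / p \<le> 1\<close>; this is where
    \<open>p \<ge> 2\<close> enters.\<close>
  also have "(G / (2 * e)) powr (2 / p) \<le> (G / (2 * e)) powr 1"
    using p s by (intro powr_mono) auto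
  \<comment> \<open>Equivalent to \<open>G / 2 \<le> G - e\<close>, that is, to a gap of at least
    \<open>2 * e\<close>.\<close>
  also have "(G / (2 * e)) powr 1 \<le> (G - e) / e"
    using divide_right_mono[of "G / 2" "G - e" e] s e by (simp add: G_def mult.commute)
  finally have D: "D\<^sup>2 \<le> ((2 * e / \<mu>) powr (1 / p))\<^sup>2 * ((G - e) / e)"
    by (simp add: mult_left_mono)
  have "f ?x - fs \<le> 2 * L * D\<^sup>2 / (real j)\<^sup>2"
    using rate[OF x(1) j0] by (simp add: D_def)
  also have "\<dots> \<le> G - e"
  proof -
    have "2 * L * D\<^sup>2 \<le> 2 * L * (((2 * e / \<mu>) powr (1 / p))\<^sup>2 * ((G - e) / e))"
      using D L by (intro mult_left_mono) auto
    also have "\<dots> = (Kd e)\<^sup>2 * (G - e)"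
      using L e by (simp add: K_dec_def)
    also have "\<dots> \<le> (real j)\<^sup>2 * (G - e)"
      using Kj Kd_pos[OF e(1)] e by (intro mult_right_mono power_mono) (auto simp: G_def)
    finally show ?thesis using j0 by (simp add: field_simps)
  qed
  finally show ?thesis by (simp add: G_def)
qed

text \<open>\<open>Kd\<close> is nonincreasing in \<open>e\<close>, and \<open>conditioning\<close>
  controls it at \<open>e = \<Delta>0\<close>. The bound lets the ceiling of \<open>Kd\<close> be
  replaced by \<open>2 * Kd\<close>.\<close>

lemma Kd_ge_1:
  assumes "0 < e" "e \<le> \<Delta>0"
  shows "1 \<le> Kd e"
proof -
  have "e powr (1 / 2 - 1 / p) \<le> \<Delta>0 powr (1 / 2 - 1 / p)"
    using assms p by (intro powr_mono2) (auto simp: field_simps)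
  also have "\<dots> \<le> sqrt (L / 2) / \<mu> powr (1 / p)" by (rule conditioning)
  also have "\<dots> \<le> sqrt 2 * 2 powr (1 / p) * (sqrt L / \<mu> powr (1 / p))"
  proof -
    have "sqrt (L / 2) \<le> sqrt 2 * 1 * sqrt L"
      using L by (simp flip: real_sqrt_mult)
    also have "\<dots> \<le> sqrt 2 * 2 powr (1 / p) * sqrt L"
      using L p by (intro mult_right_mono mult_left_mono ge_one_powr_ge_zero) auto
    finally show ?thesis using \<mu> by (simp add: divide_right_mono)
  qed
  finally show ?thesis using assms L \<mu> by (subst K_dec_doubling) (auto simp: pos_le_divide_eq mult_ac)
qed

lemma complexity:
  assumes run: "scheme_run f (\<lambda>_. accelerated L g) eps 1 x0 R"
    and eps: "\<And>k. 0 < eps k" "2 * eps 0 \<le> \<epsilon>" and M: "\<Delta>0 < eps M"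
  shows "\<exists>t. eps_optimal S f \<epsilon> (xbar (R t))"
    and "real (iteration_complexity S f \<epsilon> R) \<le> 4 * B_bound p L \<mu> \<Delta>0 eps"
    and "real (oracle_complexity S f \<epsilon> R) \<le> real (iteration_complexity S f \<epsilon> R) * (real M + 1)"
proof -
  interpret restart_run S f "\<lambda>_. accelerated L g" eps x0 R fs "\<lambda>k. nat \<lceil>Kd (eps k)\<rceil>"
  proof
    show "0 < nat \<lceil>Kd (eps k)\<rceil>" for k using Kd_pos[OF eps(1)[of k]] by simp
  qed (use run eps start accelerated_iterate_in[OF subspace_Rspace convex gradient lipschitz L]
        min_value_le progress in auto)
  define m where "m = m_index \<Delta>0 eps"
  have ne: "{k. eps k \<ge> \<Delta>0 / 2} \<noteq> {}" using M \<Delta>0 by (auto intro!: exI[of _ M])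
  then have m: "\<Delta>0 / 2 \<le> eps m" using Inf_nat_def1[OF ne] by (simp add: m_def m_index_def)
  obtain t where t: "t \<le> (\<Sum>k<m. (1 + nrestarts k) * nat \<lceil>Kd (eps k)\<rceil>)"
    "xbar (R t) \<in> S" "f (xbar (R t)) - fs \<le> 2 * eps 0"
    using reaches_target[of m] m initial_gap by auto
  then have opt: "eps_optimal S f \<epsilon> (xbar (R t))" using eps by (simp add: eps_optimal_def)
  then show "\<exists>t. eps_optimal S f \<epsilon> (xbar (R t))" by blast
  have "iteration_complexity S f \<epsilon> R \<le> t"
    unfolding iteration_complexity_def using opt by (rule Least_le)
  with t(1) have "real (iteration_complexity S f \<epsilon> R)
      \<le> real (\<Sum>k<m. (1 + nrestarts k) * nat \<lceil>Kd (eps k)\<rceil>)" by linarith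
  also have "\<dots> = (\<Sum>k<m. (1 + real (nrestarts k)) * real (nat \<lceil>Kd (eps k)\<rceil>))"
    by (simp only: of_nat_sum of_nat_mult of_nat_add of_nat_1)
  \<comment> \<open>The factor 4 is a 2 for rounding \<open>Kd\<close> up times a 2 for rounding up
    the number of restarts.\<close>
  also have "\<dots> \<le> (\<Sum>k<m. 4 * ((1 + 2 * eps (Suc k) / eps k) * Kd (eps k)))"
  proof (rule sum_mono)
    fix k assume "k \<in> {..<m}"
    then have "k < m_index \<Delta>0 eps" by (simp add: m_def)
    then have "1 \<le> Kd (eps k)" using below_m_index[of k \<Delta>0 eps] eps(1)[of k] \<Delta>0 by (intro Kd_ge_1) auto
    then have K: "real (nat \<lceil>Kd (eps k)\<rceil>) \<le> 2 * Kd (eps k)" by linarith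
    have q: "0 \<le> 2 * eps (Suc k) / eps k" using eps(1)[of k] eps(1)[of "Suc k"] by simp
    moreover have "1 + real (nat \<lceil>r\<rceil>) \<le> 2 * (1 + r)" if "0 \<le> r" for r :: real
    proof -
      have "real (nat \<lceil>r\<rceil>) = of_int \<lceil>r\<rceil>" using that by simp
      then show ?thesis using of_int_ceiling_le_add_one[of r] that by argo
    qed
    ultimately have n: "1 + real (nrestarts k) \<le> 2 * (1 + 2 * eps (Suc k) / eps k)"
      unfolding nrestarts_def by blast
    have "(1 + real (nrestarts k)) * real (nat \<lceil>Kd (eps k)\<rceil>)
        \<le> (2 * (1 + 2 * eps (Suc k) / eps k)) * (2 * Kd (eps k))"
      using K n q by (intro mult_mono) auto
    also have "\<dots> = 4 * ((1 + 2 * eps (Suc k) / eps k) * Kd (eps k))"  by simp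
    finally show "(1 + real (nrestarts k)) * real (nat \<lceil>Kd (eps k)\<rceil>)
        \<le> 4 * ((1 + 2 * eps (Suc k) / eps k) * Kd (eps k))" .
  qed
  also have "\<dots> = 4 * B_bound p L \<mu> \<Delta>0 eps"
    by (simp add: B_bound_def m_def sum_distrib_left)
  finally show "real (iteration_complexity S f \<epsilon> R) \<le> 4 * B_bound p L \<mu> \<Delta>0 eps" .
  have "oracle_complexity S f \<epsilon> R \<le> (\<Sum>t<iteration_complexity S f \<epsilon> R. Suc M)"
    unfolding oracle_complexity_def
    using nprocs_bound[of M] M initial_gap by (intro sum_mono) auto
  then have "real (oracle_complexity S f \<epsilon> R) \<le> real (iteration_complexity S f \<epsilon> R * Suc M)"
    by (simp only: of_nat_le_iff) simp
  then show "real (oracle_complexity S f \<epsilon> R) \<le> real (iteration_complexity S f \<epsilon> R) * (real M + 1)"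
    by (simp add: algebra_simps)
qed

end
text \<open>Reduces both upper bounds to estimates of \<open>B_bound\<close> and of an index
  \<open>M\<close> whose target exceeds \<open>\<Delta>0\<close>. The single constant
  \<open>C1 * C2\<close> serves both rates because \<open>1 \<le> C2\<close>.\<close>

lemma complexity_boundsI:
  fixes p C1 C2 :: real and eps :: "real \<Rightarrow> nat \<Rightarrow> real"
  assumes p: "2 \<le> p"
    and eps: "\<And>\<epsilon> k. 0 < \<epsilon> \<Longrightarrow> 0 < eps \<epsilon> k" "\<And>\<epsilon>. 0 < \<epsilon> \<Longrightarrow> 2 * eps \<epsilon> 0 \<le> \<epsilon>"
    and unbounded: "\<And>\<epsilon> \<Delta>0. 0 < \<epsilon> \<Longrightarrow> \<epsilon> < \<Delta>0 \<Longrightarrow> \<exists>M. \<Delta>0 < eps \<epsilon> M"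
    and C: "0 < C1" "1 \<le> C2"
    and ev: "\<And>L \<mu> \<Delta>0. 0 < L \<Longrightarrow> 0 < \<mu> \<Longrightarrow> 0 < \<Delta>0 \<Longrightarrow>
      \<forall>\<^sub>F \<epsilon> in at_right 0. 0 \<le> rit L \<mu> \<Delta>0 \<epsilon> \<and> 4 * B_bound p L \<mu> \<Delta>0 (eps \<epsilon>) \<le> C1 * rit L \<mu> \<Delta>0 \<epsilon>
        \<and> (\<exists>M. \<Delta>0 < eps \<epsilon> M \<and> real M + 1 \<le> C2 * l (\<Delta>0 / \<epsilon>))"
  shows "complexity_bounds p eps rit (\<lambda>L \<mu> \<Delta>0 \<epsilon>. rit L \<mu> \<Delta>0 \<epsilon> * l (\<Delta>0 / \<epsilon>))"
proof -
  have problem_locale: "growth_problem p L \<mu> \<Delta>0 d f g x0"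
    if "0 < L" "0 < \<mu>" "0 < \<Delta>0" "problem p L \<mu> \<Delta>0 d f g x0" for L \<mu> \<Delta>0 d f g x0
    by standard (use that p in auto)
  have bounds: "real (iteration_complexity (Rspace d) f \<epsilon> R) \<le> C1 * C2 * rit L \<mu> \<Delta>0 \<epsilon> \<and>
      real (oracle_complexity (Rspace d) f \<epsilon> R) \<le> C1 * C2 * (rit L \<mu> \<Delta>0 \<epsilon> * l (\<Delta>0 / \<epsilon>))"
    if a: "0 < L" "0 < \<mu>" "0 < \<Delta>0" "0 < \<epsilon>" "problem p L \<mu> \<Delta>0 d f g x0"
      and run: "scheme_run f (\<lambda>_. accelerated L g) (eps \<epsilon>) 1 x0 R"
      and B: "0 \<le> rit L \<mu> \<Delta>0 \<epsilon>" "4 * B_bound p L \<mu> \<Delta>0 (eps \<epsilon>) \<le> C1 * rit L \<mu> \<Delta>0 \<epsilon>"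
      and M: "\<Delta>0 < eps \<epsilon> M" "real M + 1 \<le> C2 * l (\<Delta>0 / \<epsilon>)" for L \<mu> \<Delta>0 \<epsilon> d f g x0 R M
  proof -
    note cb = growth_problem.complexity[OF problem_locale[OF a(1-3,5)] run eps(1)[OF a(4)] eps(2)[OF a(4)] M(1)]
    define r where "r = C1 * rit L \<mu> \<Delta>0 \<epsilon>"
    have r: "0 \<le> r" using B(1) C(1) by (simp add: r_def)
    have it: "real (iteration_complexity (Rspace d) f \<epsilon> R) \<le> r"
      using cb(2) B(2) by (simp add: r_def)
    moreover have "r * 1 \<le> r * C2" by (rule mult_left_mono[OF C(2) r])
    moreover have "real (iteration_complexity (Rspace d) f \<epsilon> R) * (real M + 1) \<le> r * (C2 * l (\<Delta>0 / \<epsilon>))"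
      using it M(2) r by (intro mult_mono) auto
    ultimately show ?thesis using cb(3) by (simp add: r_def mult_ac)
  qed
  show ?thesis
    unfolding complexity_bounds_def
  proof (intro conjI allI impI exI[of _ "C1 * C2"])
    fix L \<mu> \<Delta>0 \<epsilon> :: real and d f g x0 R
    assume a: "0 < L" "0 < \<mu>" "0 < \<epsilon>" "\<epsilon> < \<Delta>0" "problem p L \<mu> \<Delta>0 d f g x0"
      and run: "scheme_run f (\<lambda>_. accelerated L g) (eps \<epsilon>) 1 x0 R"
    obtain M where "\<Delta>0 < eps \<epsilon> M" using unbounded a by blast
    from growth_problem.complexity(1)[OF problem_locale[OF a(1,2) _ a(5)] run eps(1)[OF a(3)] eps(2)[OF a(3)] this]
    show "\<exists>t. eps_optimal (Rspace d) f \<epsilon> (xbar (R t))" using a by simp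
  next
    show "0 < C1 * C2" using C by simp
  next
    fix L \<mu> \<Delta>0 :: real assume a: "0 < L" "0 < \<mu>" "0 < \<Delta>0"
    show "\<forall>\<^sub>F \<epsilon> in at_right 0. \<forall>d f g x0 R.
        problem p L \<mu> \<Delta>0 d f g x0 \<longrightarrow>
        scheme_run f (\<lambda>_. accelerated L g) (eps \<epsilon>) 1 x0 R \<longrightarrow>
        real (iteration_complexity (Rspace d) f \<epsilon> R) \<le> C1 * C2 * rit L \<mu> \<Delta>0 \<epsilon> \<and>
        real (oracle_complexity (Rspace d) f \<epsilon> R) \<le> C1 * C2 * (rit L \<mu> \<Delta>0 \<epsilon> * l (\<Delta>0 / \<epsilon>))"
      using ev[OF a] eventually_at_right_less[of 0]
      by eventually_elim (use bounds a in blast)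
  qed
qed

section \<open>Evaluation of the bound for the proposed targets\<close>

text \<open>The added 1 keeps the inequality strict even when the quotient of logarithms is an
  integer.\<close>

lemma ceiling_exceeds:
  fixes y c :: real
  assumes "1 < c" "1 \<le> y"
  defines "M \<equiv> nat \<lceil>ln y / ln c\<rceil> + 1"
  shows "y < c ^ M" "real M \<le> ln y / ln c + 2"
proof -
  have "0 \<le> ln y / ln c" using assms by simp
  then show "real M \<le> ln y / ln c + 2" unfolding M_def by linarith
  have "ln y / ln c < real M" unfolding M_def by linarith
  then have "ln y < ln (c ^ M)" using assms(1) by (simp add: field_simps ln_realpow)
  then show "y < c ^ M" using assms(1,2) by simp
qed

lemma B_bound_eq:
  assumes "0 < L" "0 < \<mu>" "\<And>k. 0 < e k"
  shows "B_bound p L \<mu> \<Delta>0 e = sqrt 2 * 2 powr (1 / p) * (sqrt L / \<mu> powr (1 / p))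
    * (\<Sum>k<m_index \<Delta>0 e. (1 + 2 * e (Suc k) / e k) * (1 / e k powr (1 / 2 - 1 / p)))"
  unfolding B_bound_def sum_distrib_left
  by (intro sum.cong refl, subst K_dec_doubling) (simp_all add: assms mult_ac)

text \<open>By \<open>exp u \<ge> u\<close>, the terms are dominated by a geometric series with
  ratio \<open>1 / c\<close>.\<close>

lemma sum_exp_neg_power_le:
  fixes \<beta> c :: real
  assumes "0 < \<beta>" "1 < c"
  shows "(\<Sum>k<m. exp (- \<beta> * c ^ k)) \<le> 1 / \<beta> * (1 / (1 - 1 / c))"
proof -
  have "(\<Sum>k<m. exp (- \<beta> * c ^ k)) \<le> (\<Sum>k<m. 1 / \<beta> * (1 / c) ^ k)"
  proof (rule sum_mono)
    fix k
    have "0 < \<beta> * c ^ k" using assms by simp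
    moreover have "\<beta> * c ^ k \<le> exp (\<beta> * c ^ k)" using exp_ge_add_one_self[of "\<beta> * c ^ k"] by linarith
    ultimately have "inverse (exp (\<beta> * c ^ k)) \<le> inverse (\<beta> * c ^ k)" by (rule le_imp_inverse_le[rotated])
    then show "exp (- \<beta> * c ^ k) \<le> 1 / \<beta> * (1 / c) ^ k"
      by (simp add: exp_minus divide_inverse power_inverse)
  qed
  also have "\<dots> = 1 / \<beta> * (\<Sum>k<m. (1 / c) ^ k)" by (simp add: sum_distrib_left)
  also have "\<dots> \<le> 1 / \<beta> * (1 / (1 - 1 / c))"
  proof (rule mult_left_mono)
    have "(\<Sum>k<m. (1 / c) ^ k) \<le> (\<Sum>k. (1 / c) ^ k)"
      using assms by (intro sum_le_suminf summable_geometric) auto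
    also have "\<dots> = 1 / (1 - 1 / c)" using assms by (intro suminf_geometric) auto
    finally show "(\<Sum>k<m. (1 / c) ^ k) \<le> 1 / (1 - 1 / c)" .
  qed (use assms in simp)
  finally show ?thesis .
qed

lemma complexity_bounds_superlinear:
  fixes p c :: real
  assumes p: "2 < p" and c: "1 < c" "c < 3 / 2 - 1 / p"
  shows "complexity_bounds p (\<lambda>\<epsilon> k. \<epsilon> / (2 * exp 1) * exp (c ^ k))
    (\<lambda>L \<mu> \<Delta>0 \<epsilon>. sqrt L / \<mu> powr (1 / p) * (1 / \<epsilon> powr (1 / 2 - 1 / p)))
    (\<lambda>L \<mu> \<Delta>0 \<epsilon>. sqrt L / \<mu> powr (1 / p) * (1 / \<epsilon> powr (1 / 2 - 1 / p)) * ln (ln (\<Delta>0 / \<epsilon>)))"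
proof -
  define \<alpha> where "\<alpha> = 1 / 2 - 1 / p"
  define eps where "eps = (\<lambda>\<epsilon>::real. \<lambda>k. \<epsilon> / (2 * exp 1) * exp (c ^ k))"
  define \<rho> where "\<rho> = (\<lambda>L \<mu>. sqrt L / \<mu> powr (1 / p))"
  define A where "A = sqrt 2 * 2 powr (1 / p)"
  \<comment> \<open>The weights decay like \<open>exp (- \<alpha> * c ^ k)\<close> while the ratios
    of consecutive targets grow like \<open>exp ((c - 1) * c ^ k)\<close>. The net exponent
    \<open>\<beta>\<close> is positive exactly when \<open>c < 3 / 2 - 1 / p\<close>.\<close>
  define \<beta> where "\<beta> = \<alpha> - (c - 1)"
  have \<beta>: "0 < \<beta>" using c by (simp add: \<beta>_def \<alpha>_def)
  \<comment> \<open>The 4 comes from \<open>complexity\<close>, \<open>A\<close> from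
    \<open>K_dec_doubling\<close>, the 3 from \<open>1 + 2 * r \<le> 3 * r\<close> for ratios
    \<open>r \<ge> 1\<close>, the power from the prefactor of the targets, and the rest from
    \<open>sum_exp_neg_power_le\<close>.\<close>
  define C1 where "C1 = 4 * (A * (3 * ((2 * exp 1) powr \<alpha> * (1 / \<beta> * (1 / (1 - 1 / c))))))"
  have C1: "0 < C1" using c \<beta> by (simp add: C1_def A_def)
  have eps: "0 < eps \<epsilon> k" "2 * eps \<epsilon> 0 \<le> \<epsilon>" if "0 < \<epsilon>" for \<epsilon> k
    using that by (auto simp: eps_def)
  have B: "4 * B_bound p L \<mu> \<Delta>0 (eps \<epsilon>) \<le> C1 * (\<rho> L \<mu> * (1 / \<epsilon> powr \<alpha>))"
    if "0 < L" "0 < \<mu>" "0 < \<epsilon>" for L \<mu> \<Delta>0 \<epsilon>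
  proof -
    define m where "m = m_index \<Delta>0 (eps \<epsilon>)"
    have "(\<Sum>k<m. (1 + 2 * eps \<epsilon> (Suc k) / eps \<epsilon> k) * (1 / eps \<epsilon> k powr \<alpha>))
      \<le> (\<Sum>k<m. 3 * ((2 * exp 1) powr \<alpha> * (1 / \<epsilon> powr \<alpha>)) * exp (- \<beta> * c ^ k))"
    proof (rule sum_mono)
      fix k
      have r: "eps \<epsilon> (Suc k) / eps \<epsilon> k = exp ((c - 1) * c ^ k)"
        using that by (simp add: eps_def algebra_simps flip: exp_diff)
      have w: "1 / eps \<epsilon> k powr \<alpha> = (2 * exp 1) powr \<alpha> * (1 / \<epsilon> powr \<alpha>) * exp (- \<alpha> * c ^ k)"
        using that by (simp add: eps_def powr_mult powr_divide exp_minus field_simps)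
          (simp add: powr_def)
      have "1 \<le> exp ((c - 1) * c ^ k)" using c by simp
      then have "1 + 2 * eps \<epsilon> (Suc k) / eps \<epsilon> k \<le> 3 * exp ((c - 1) * c ^ k)"
        unfolding times_divide_eq_right[symmetric] r by linarith
      then have "(1 + 2 * eps \<epsilon> (Suc k) / eps \<epsilon> k) * (1 / eps \<epsilon> k powr \<alpha>)
          \<le> 3 * exp ((c - 1) * c ^ k) * (1 / eps \<epsilon> k powr \<alpha>)"
        by (rule mult_right_mono) simp
      also have "\<dots> = 3 * ((2 * exp 1) powr \<alpha> * (1 / \<epsilon> powr \<alpha>)) * exp (- \<beta> * c ^ k)"
        unfolding w by (simp add: \<beta>_def algebra_simps flip: exp_add)
      finally show "(1 + 2 * eps \<epsilon> (Suc k) / eps \<epsilon> k) * (1 / eps \<epsilon> k powr \<alpha>)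
        \<le> 3 * ((2 * exp 1) powr \<alpha> * (1 / \<epsilon> powr \<alpha>)) * exp (- \<beta> * c ^ k)" .
    qed
    also have "\<dots> = 3 * ((2 * exp 1) powr \<alpha> * (1 / \<epsilon> powr \<alpha>)) * (\<Sum>k<m. exp (- \<beta> * c ^ k))"
      by (simp add: sum_distrib_left)
    also have "\<dots> \<le> 3 * ((2 * exp 1) powr \<alpha> * (1 / \<epsilon> powr \<alpha>)) * (1 / \<beta> * (1 / (1 - 1 / c)))"
      using sum_exp_neg_power_le[OF \<beta> c(1)] by (intro mult_left_mono) auto
    finally have "4 * (A * \<rho> L \<mu> * (\<Sum>k<m. (1 + 2 * eps \<epsilon> (Suc k) / eps \<epsilon> k) * (1 / eps \<epsilon> k powr \<alpha>)))
        \<le> 4 * (A * \<rho> L \<mu> * (3 * ((2 * exp 1) powr \<alpha> * (1 / \<epsilon> powr \<alpha>)) * (1 / \<beta> * (1 / (1 - 1 / c)))))"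
      using that by (intro mult_left_mono) (auto simp: A_def \<rho>_def)
    also have "\<dots> = C1 * (\<rho> L \<mu> * (1 / \<epsilon> powr \<alpha>))"
      by (simp add: C1_def mult_ac)
    finally show ?thesis using B_bound_eq[OF that(1,2), of "eps \<epsilon>"] eps that
      by (simp add: A_def \<rho>_def \<alpha>_def m_def)
  qed
  \<comment> \<open>The target exceeds \<open>\<Delta>0\<close> once \<open>c ^ k\<close> exceeds
    \<open>ln (2 * exp 1 * (\<Delta>0 / \<epsilon>))\<close>.\<close>
  define M where "M = (\<lambda>X. nat \<lceil>ln (ln (2 * exp 1 * X)) / ln c\<rceil> + 1)"
  have M: "\<Delta>0 < eps \<epsilon> (M (\<Delta>0 / \<epsilon>))" "real (M (\<Delta>0 / \<epsilon>)) \<le> ln (ln (2 * exp 1 * (\<Delta>0 / \<epsilon>))) / ln c + 2"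
    if "0 < \<epsilon>" "\<epsilon> < \<Delta>0" for \<epsilon> \<Delta>0
  proof -
    have "exp 1 * 1 \<le> 2 * exp 1 * (\<Delta>0 / \<epsilon>)" using that by (intro mult_mono) auto
    then have "ln (exp 1) \<le> ln (2 * exp 1 * (\<Delta>0 / \<epsilon>))" using that by (subst ln_le_cancel_iff) auto
    then have y: "1 \<le> ln (2 * exp 1 * (\<Delta>0 / \<epsilon>))" by simp
    show "real (M (\<Delta>0 / \<epsilon>)) \<le> ln (ln (2 * exp 1 * (\<Delta>0 / \<epsilon>))) / ln c + 2"
      unfolding M_def by (rule ceiling_exceeds[OF c(1) y])
    have "ln (2 * exp 1 * (\<Delta>0 / \<epsilon>)) < c ^ M (\<Delta>0 / \<epsilon>)"
      unfolding M_def by (rule ceiling_exceeds[OF c(1) y])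
    then have "exp (ln (2 * exp 1 * (\<Delta>0 / \<epsilon>))) < exp (c ^ M (\<Delta>0 / \<epsilon>))" by simp
    then have "2 * exp 1 * (\<Delta>0 / \<epsilon>) < exp (c ^ M (\<Delta>0 / \<epsilon>))" using that by simp
    then show "\<Delta>0 < eps \<epsilon> (M (\<Delta>0 / \<epsilon>))" using that by (simp add: eps_def field_simps)
  qed
  \<comment> \<open>The constant 3 collects the 2 from \<open>ceiling_exceeds\<close> and the 1 in
    \<open>real M + 1\<close>; it is absorbed once the double logarithm is at least 1.\<close>
  define C2 where "C2 = 2 / ln c + 3"
  have large: "\<forall>\<^sub>F X in at_top. 1 < X \<and> 1 \<le> ln (ln X) \<and> ln (ln (2 * exp 1 * X)) \<le> 2 * ln (ln (X::real))"
  proof (intro eventually_conj)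
    show "\<forall>\<^sub>F X in at_top. (1::real) < X" by real_asymp
    show "\<forall>\<^sub>F X in at_top. 1 \<le> ln (ln (X::real))" by real_asymp
    show "\<forall>\<^sub>F X in at_top. ln (ln (2 * exp 1 * X)) \<le> 2 * ln (ln (X::real))" by real_asymp
  qed
  have "complexity_bounds p eps (\<lambda>L \<mu> \<Delta>0 \<epsilon>. \<rho> L \<mu> * (1 / \<epsilon> powr \<alpha>))
    (\<lambda>L \<mu> \<Delta>0 \<epsilon>. \<rho> L \<mu> * (1 / \<epsilon> powr \<alpha>) * ln (ln (\<Delta>0 / \<epsilon>)))"
  proof (rule complexity_boundsI[where l = "\<lambda>X. ln (ln X)"])
    show "2 \<le> p" "0 < C1" "1 \<le> C2" using p C1 c by (auto simp: C2_def)
    show "\<exists>M. \<Delta>0 < eps \<epsilon> M" if "0 < \<epsilon>" "\<epsilon> < \<Delta>0" for \<epsilon> \<Delta>0 using M(1)[OF that] by blast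
    fix L \<mu> \<Delta>0 :: real assume a: "0 < L" "0 < \<mu>" "0 < \<Delta>0"
    show "\<forall>\<^sub>F \<epsilon> in at_right 0. 0 \<le> \<rho> L \<mu> * (1 / \<epsilon> powr \<alpha>) \<and>
        4 * B_bound p L \<mu> \<Delta>0 (eps \<epsilon>) \<le> C1 * (\<rho> L \<mu> * (1 / \<epsilon> powr \<alpha>)) \<and>
        (\<exists>M. \<Delta>0 < eps \<epsilon> M \<and> real M + 1 \<le> C2 * ln (ln (\<Delta>0 / \<epsilon>)))"
      using eventually_ratio[OF large a(3)] eventually_at_right_less[of 0]
    proof eventually_elim
      case (elim \<epsilon>)
      then have lt: "\<epsilon> < \<Delta>0" by simp
      have "ln (ln (2 * exp 1 * (\<Delta>0 / \<epsilon>))) / ln c \<le> 2 * ln (ln (\<Delta>0 / \<epsilon>)) / ln c"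
        using elim c by (intro divide_right_mono) auto
      then have "real (M (\<Delta>0 / \<epsilon>)) + 1 \<le> 2 / ln c * ln (ln (\<Delta>0 / \<epsilon>)) + 3"
        using M(2)[OF elim(2) lt] by simp
      also have "\<dots> \<le> C2 * ln (ln (\<Delta>0 / \<epsilon>))" using elim by (simp add: C2_def algebra_simps)
      finally show ?case using M(1)[OF elim(2) lt] B[OF a(1,2) elim(2)] a by (auto simp: \<rho>_def)
    qed
  qed (use eps in auto)
  then show ?thesis by (simp add: \<rho>_def \<alpha>_def eps_def)
qed

text \<open>For \<open>p = 2\<close> the exponent \<open>1 / 2 - 1 / p\<close> vanishes and the
  targets are geometric, so all summands of the bound are equal and only their number
  matters.\<close>

lemma complexity_bounds_quadratic:
  fixes c :: real
  assumes c: "1 < c"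
  shows "complexity_bounds 2 (\<lambda>\<epsilon> k. \<epsilon> / 2 * c ^ k)
    (\<lambda>L \<mu> \<Delta>0 \<epsilon>. sqrt (L / \<mu>) * ln (\<Delta>0 / \<epsilon>))
    (\<lambda>L \<mu> \<Delta>0 \<epsilon>. sqrt (L / \<mu>) * (ln (\<Delta>0 / \<epsilon>))\<^sup>2)"
proof -
  define eps where "eps = (\<lambda>\<epsilon>::real. \<lambda>k. \<epsilon> / 2 * c ^ k)"
  define C1 where "C1 = 8 * (1 + 2 * c) * (1 / ln c + 1)"
  have C1: "0 < C1" using c by (simp add: C1_def add_pos_pos)
  have eps: "0 < eps \<epsilon> k" "2 * eps \<epsilon> 0 \<le> \<epsilon>" if "0 < \<epsilon>" for \<epsilon> k
    using that c by (auto simp: eps_def)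
  \<comment> \<open>The target before index m is still below \<open>\<Delta>0 / 2\<close>, so
    \<open>c ^ (m - 1) < \<Delta>0 / \<epsilon>\<close>.\<close>
  have m_le: "real (m_index \<Delta>0 (eps \<epsilon>)) \<le> ln (\<Delta>0 / \<epsilon>) / ln c + 1"
    if "0 < \<epsilon>" "\<epsilon> < \<Delta>0" for \<Delta>0 \<epsilon>
  proof (cases "m_index \<Delta>0 (eps \<epsilon>)")
    case 0
    have "0 \<le> ln (\<Delta>0 / \<epsilon>) / ln c" using that c by simp
    with 0 show ?thesis by simp
  next
    case (Suc k)
    then have "eps \<epsilon> k < \<Delta>0 / 2" by (intro below_m_index) simp
    then have "c ^ k < \<Delta>0 / \<epsilon>" using that by (simp add: eps_def field_simps)
    then have "ln (c ^ k) < ln (\<Delta>0 / \<epsilon>)" using that c by (subst ln_less_cancel_iff) auto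
    then show ?thesis using Suc c by (simp add: ln_realpow field_simps)
  qed
  have B: "4 * B_bound 2 L \<mu> \<Delta>0 (eps \<epsilon>) \<le> C1 * (sqrt (L / \<mu>) * ln (\<Delta>0 / \<epsilon>))"
    if a: "0 < L" "0 < \<mu>" "0 < \<epsilon>" "\<epsilon> < \<Delta>0" and X: "1 \<le> ln (\<Delta>0 / \<epsilon>)" for L \<mu> \<Delta>0 \<epsilon>
  proof -
    have r: "eps \<epsilon> (Suc k) / eps \<epsilon> k = c" for k using a c by (simp add: eps_def)
    have r2: "1 + 2 * eps \<epsilon> (Suc k) / eps \<epsilon> k = 1 + 2 * c" for k
      unfolding times_divide_eq_right[symmetric] r ..
    have "eps \<epsilon> k powr 0 = 1" for k using eps(1)[OF a(3), of k] by simp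
    then have "B_bound 2 L \<mu> \<Delta>0 (eps \<epsilon>)
        = 2 * sqrt (L / \<mu>) * (real (m_index \<Delta>0 (eps \<epsilon>)) * (1 + 2 * c))"
      using B_bound_eq[OF a(1,2), of "eps \<epsilon>" 2 \<Delta>0] eps[OF a(3)] a
      by (simp add: r2 powr_half_sqrt real_sqrt_divide)
    also have "\<dots> \<le> 2 * sqrt (L / \<mu>) * ((1 / ln c + 1) * ln (\<Delta>0 / \<epsilon>) * (1 + 2 * c))"
      using m_le[OF a(3,4)] X c a
      by (intro mult_left_mono mult_right_mono) (auto simp: algebra_simps)
    finally have "4 * B_bound 2 L \<mu> \<Delta>0 (eps \<epsilon>)
        \<le> 4 * (2 * sqrt (L / \<mu>) * ((1 / ln c + 1) * ln (\<Delta>0 / \<epsilon>) * (1 + 2 * c)))" by (rule mult_left_mono) simp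
    also have "\<dots> = C1 * (sqrt (L / \<mu>) * ln (\<Delta>0 / \<epsilon>))" by (simp add: C1_def)
    finally show ?thesis .
  qed
  define M where "M = (\<lambda>X. nat \<lceil>ln (2 * X) / ln c\<rceil> + 1)"
  have M: "\<Delta>0 < eps \<epsilon> (M (\<Delta>0 / \<epsilon>))" "real (M (\<Delta>0 / \<epsilon>)) \<le> ln (2 * (\<Delta>0 / \<epsilon>)) / ln c + 2"
    if "0 < \<epsilon>" "\<epsilon> < \<Delta>0" for \<epsilon> \<Delta>0
  proof -
    have y: "1 \<le> 2 * (\<Delta>0 / \<epsilon>)" using that by (simp add: field_simps)
    show "real (M (\<Delta>0 / \<epsilon>)) \<le> ln (2 * (\<Delta>0 / \<epsilon>)) / ln c + 2"
      unfolding M_def by (rule ceiling_exceeds[OF c y])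
    have "2 * (\<Delta>0 / \<epsilon>) < c ^ M (\<Delta>0 / \<epsilon>)"
      unfolding M_def by (rule ceiling_exceeds[OF c y])
    then show "\<Delta>0 < eps \<epsilon> (M (\<Delta>0 / \<epsilon>))" using that by (simp add: eps_def field_simps)
  qed
  define C2 where "C2 = 2 / ln c + 3"
  have large: "\<forall>\<^sub>F X in at_top. 1 < X \<and> 1 \<le> ln X \<and> ln (2 * X) \<le> 2 * ln (X::real)"
  proof (intro eventually_conj)
    show "\<forall>\<^sub>F X in at_top. (1::real) < X" by real_asymp
    show "\<forall>\<^sub>F X in at_top. 1 \<le> ln (X::real)" by real_asymp
    show "\<forall>\<^sub>F X in at_top. ln (2 * X) \<le> 2 * ln (X::real)" by real_asymp
  qed
  have "complexity_bounds 2 eps (\<lambda>L \<mu> \<Delta>0 \<epsilon>. sqrt (L / \<mu>) * ln (\<Delta>0 / \<epsilon>))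
    (\<lambda>L \<mu> \<Delta>0 \<epsilon>. sqrt (L / \<mu>) * ln (\<Delta>0 / \<epsilon>) * ln (\<Delta>0 / \<epsilon>))"
  proof (rule complexity_boundsI[where l = ln])
    show "0 < C1" "1 \<le> C2" using C1 c by (auto simp: C2_def)
    show "\<exists>M. \<Delta>0 < eps \<epsilon> M" if "0 < \<epsilon>" "\<epsilon> < \<Delta>0" for \<epsilon> \<Delta>0 using M(1)[OF that] by blast
    fix L \<mu> \<Delta>0 :: real assume a: "0 < L" "0 < \<mu>" "0 < \<Delta>0"
    show "\<forall>\<^sub>F \<epsilon> in at_right 0. 0 \<le> sqrt (L / \<mu>) * ln (\<Delta>0 / \<epsilon>) \<and>
        4 * B_bound 2 L \<mu> \<Delta>0 (eps \<epsilon>) \<le> C1 * (sqrt (L / \<mu>) * ln (\<Delta>0 / \<epsilon>)) \<and>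
        (\<exists>M. \<Delta>0 < eps \<epsilon> M \<and> real M + 1 \<le> C2 * ln (\<Delta>0 / \<epsilon>))"
      using eventually_ratio[OF large a(3)] eventually_at_right_less[of 0]
    proof eventually_elim
      case (elim \<epsilon>)
      then have lt: "\<epsilon> < \<Delta>0" by simp
      have "ln (2 * (\<Delta>0 / \<epsilon>)) / ln c \<le> 2 * ln (\<Delta>0 / \<epsilon>) / ln c"
        using elim c by (intro divide_right_mono) auto
      then have "real (M (\<Delta>0 / \<epsilon>)) + 1 \<le> 2 / ln c * ln (\<Delta>0 / \<epsilon>) + 3"
        using M(2)[OF elim(2) lt] by simp
      also have "\<dots> \<le> C2 * ln (\<Delta>0 / \<epsilon>)" using elim by (simp add: C2_def algebra_simps)
      moreover have "0 \<le> sqrt (L / \<mu>) * ln (\<Delta>0 / \<epsilon>)" using elim a by simp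
      ultimately show ?case using M(1)[OF elim(2) lt] B[OF a(1,2) elim(2) lt] elim by fastforce
    qed
  qed (use eps in auto)
  then show ?thesis by (simp add: eps_def power2_eq_square mult.assoc)
qed

section \<open>Optimality of the targets\<close>

lemma admissible_indices:
  assumes "e \<in> admissible_targets \<epsilon>"
  shows "\<Delta>0 / 2 \<le> e (m_index \<Delta>0 e)" "0 < \<Delta>0 \<Longrightarrow> m_index \<Delta>0 e \<le> mhat_index \<Delta>0 e"
proof -
  have large: "\<exists>k. b < e k" for b
    using assms eventually_happens[OF filterlim_at_top_dense[THEN iffD1, rule_format, of e sequentially b]]
    by (auto simp: admissible_targets_def)
  have "{k. \<Delta>0 / 2 \<le> e k} \<noteq> {}" 
    using large[of "\<Delta>0 / 2"] less_imp_le by blast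
  from Inf_nat_def1[OF this] show "\<Delta>0 / 2 \<le> e (m_index \<Delta>0 e)" by (simp add: m_index_def)
  have "{k. \<Delta>0 < e k} \<noteq> {}" using large[of \<Delta>0] by auto
  from Inf_nat_def1[OF this] have "\<Delta>0 < e (mhat_index \<Delta>0 e)" by (simp add: mhat_index_def)
  then show "m_index \<Delta>0 e \<le> mhat_index \<Delta>0 e" if "0 < \<Delta>0"
    unfolding m_index_def by (rule_tac cInf_lower) (use that in auto)
qed

text \<open>Shifting by the fixed point \<open>- w / a\<close> turns the affine recurrence into a
  geometric one.\<close>

lemma affine_recurrence_le:
  fixes y :: "nat \<Rightarrow> real"
  assumes "0 < a" "0 \<le> w" "y 0 \<le> 0" "\<And>k. k < m \<Longrightarrow> y (Suc k) \<le> w + (1 + a) * y k"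
  shows "y m \<le> (1 + a) ^ m * (w / a)"
proof -
  have "y k + w / a \<le> (1 + a) ^ k * (w / a)" if "k \<le> m" for k
    using that
  proof (induction k)
    case 0
    then show ?case using assms by simp
  next
    case (Suc k)
    have "y (Suc k) + w / a \<le> (1 + a) * (y k + w / a)"
    proof -
      have "(1 + a) * (w / a) = w + w / a" using assms(1) by (simp add: field_simps)
      then show ?thesis using assms(4)[of k] Suc.prems by (simp add: distrib_left)
    qed
    also have "\<dots> \<le> (1 + a) * ((1 + a) ^ k * (w / a))"
      using Suc assms(1) by (intro mult_left_mono) auto
    finally show ?case by (simp add: mult.assoc)
  qed
  moreover have "0 \<le> w / a" using assms by simp
  ultimately show ?thesis by fastforce
qed

lemma no_better_targetsI:
  assumes "\<And>L \<mu> \<Delta>0. 0 < L \<Longrightarrow> 0 < \<mu> \<Longrightarrow> 0 < \<Delta>0 \<Longrightarrow> \<forall>\<^sub>F \<epsilon> in at_right 0. \<forall>e\<in>admissible_targets \<epsilon>.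
    rit L \<mu> \<Delta>0 \<epsilon> \<le> B_bound p L \<mu> \<Delta>0 e \<and>
    ror L \<mu> \<Delta>0 \<epsilon> \<le> (real (mhat_index \<Delta>0 e) + 1) * B_bound p L \<mu> \<Delta>0 e"
  shows "no_better_targets p rit ror"
  unfolding no_better_targets_def
proof (intro exI[of _ 1] conjI allI impI)
  fix L \<mu> \<Delta>0 :: real assume a: "0 < L" "0 < \<mu>" "0 < \<Delta>0"
  show "\<forall>\<^sub>F \<epsilon> in at_right 0.
        (INF e\<in>admissible_targets \<epsilon>. B_bound p L \<mu> \<Delta>0 e) \<ge> 1 * rit L \<mu> \<Delta>0 \<epsilon> \<and>
        (INF e\<in>admissible_targets \<epsilon>. (real (mhat_index \<Delta>0 e) + 1) * B_bound p L \<mu> \<Delta>0 e)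
          \<ge> 1 * ror L \<mu> \<Delta>0 \<epsilon>"
    using assms[OF a] eventually_at_right_less[of 0]
    by eventually_elim (auto intro!: cINF_greatest admissible_targets_nonempty)
qed simp

lemma no_better_targets_superlinear:
  fixes p :: real
  assumes p: "2 < p"
  shows "no_better_targets p
    (\<lambda>L \<mu> \<Delta>0 \<epsilon>. sqrt L / \<mu> powr (1 / p) * (1 / \<epsilon> powr (1 / 2 - 1 / p)))
    (\<lambda>L \<mu> \<Delta>0 \<epsilon>. sqrt L / \<mu> powr (1 / p) * (1 / \<epsilon> powr (1 / 2 - 1 / p)) * ln (ln (\<Delta>0 / \<epsilon>)))"
proof (rule no_better_targetsI)
  define \<alpha> where "\<alpha> = 1 / 2 - 1 / p"
  have \<alpha>: "0 < \<alpha>" "\<alpha> < 1 / 2" using p by (auto simp: \<alpha>_def field_simps)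
  define w where "w = (\<lambda>X::real. ln (ln (ln X)))"
  \<comment> \<open>\<open>w X\<close> is the additive term of the recurrence for the log-targets.
    Its logarithm is of lower order than \<open>ln (ln X)\<close>, so half of
    \<open>ln (ln X)\<close> survives.\<close>
  have large: "\<forall>\<^sub>F X in at_top. 2 < X \<and> 0 < ln (ln X) \<and> 0 < w X \<and> 0 < ln (X / 2)
      \<and> ln (ln X) / 2 \<le> ln (ln (X / 2)) - ln (w X / \<alpha>)"
    unfolding w_def
  proof (intro eventually_conj)
    show "\<forall>\<^sub>F X in at_top. ln (ln X) / 2 \<le> ln (ln (X / 2)) - ln (ln (ln (ln X)) / \<alpha>)"
      using \<alpha> by real_asymp
  qed real_asymp+
  fix L \<mu> \<Delta>0 :: real assume a: "0 < L" "0 < \<mu>" "0 < \<Delta>0"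
  define \<rho> where "\<rho> = sqrt L / \<mu> powr (1 / p)"
  define A where "A = sqrt 2 * 2 powr (1 / p)"
  have \<rho>: "0 < \<rho>" using a by (simp add: \<rho>_def)
  have "1 * 1 \<le> A" unfolding A_def using p by (intro mult_mono ge_one_powr_ge_zero) auto
  then have A: "1 \<le> A" by simp
  show "\<forall>\<^sub>F \<epsilon> in at_right 0. \<forall>e\<in>admissible_targets \<epsilon>.
    sqrt L / \<mu> powr (1 / p) * (1 / \<epsilon> powr (1 / 2 - 1 / p)) \<le> B_bound p L \<mu> \<Delta>0 e \<and>
    sqrt L / \<mu> powr (1 / p) * (1 / \<epsilon> powr (1 / 2 - 1 / p)) * ln (ln (\<Delta>0 / \<epsilon>))
      \<le> (real (mhat_index \<Delta>0 e) + 1) * B_bound p L \<mu> \<Delta>0 e"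
    unfolding \<alpha>_def[symmetric] \<rho>_def[symmetric]
    using eventually_ratio[OF large a(3)] eventually_at_right_less[of 0]
  proof eventually_elim
    case (elim \<epsilon>)
    define X where "X = \<Delta>0 / \<epsilon>"
    have X: "2 < X" "0 < ln (ln X)" "0 < w X" "0 < ln (X / 2)"
      "ln (ln X) / 2 \<le> ln (ln (X / 2)) - ln (w X / \<alpha>)" and \<epsilon>: "0 < \<epsilon>"
      using elim by (auto simp: X_def)
    define W where "W = ln (ln X)"
    show ?case
    proof
      fix e assume e: "e \<in> admissible_targets \<epsilon>"
      have ep: "0 < e k" for k using e by (simp add: admissible_targets_def)
      have e0: "e 0 \<le> \<epsilon> / 2" using e by (simp add: admissible_targets_def)
      define m where "m = m_index \<Delta>0 e"
      define B where "B = B_bound p L \<mu> \<Delta>0 e"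
      have em: "\<Delta>0 / 2 \<le> e m" using admissible_indices(1)[OF e] by (simp add: m_def)
      have mm: "m \<le> mhat_index \<Delta>0 e" using admissible_indices(2)[OF e] a by (simp add: m_def)
      have "\<epsilon> / 2 < \<Delta>0 / 2" using X(1) \<epsilon> by (simp add: X_def field_simps)
      then have m0: "0 < m" using em e0 by (cases m) auto
      define q where "q = (\<lambda>k. (1 + 2 * e (Suc k) / e k) * (1 / e k powr \<alpha>))"
      have q0: "0 \<le> q k" for k using ep[of k] ep[of "Suc k"] by (simp add: q_def)
      have "B = A * \<rho> * (\<Sum>k<m. q k)"
        using B_bound_eq[of L \<mu> e p \<Delta>0] a ep by (simp add: B_def A_def \<rho>_def q_def \<alpha>_def m_def)
      moreover have "1 * \<rho> * (\<Sum>k<m. q k) \<le> A * \<rho> * (\<Sum>k<m. q k)"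
        using A \<rho> q0 by (intro mult_right_mono sum_nonneg) auto
      ultimately have Bq: "\<rho> * (\<Sum>k<m. q k) \<le> B" by simp
      have summand: "\<rho> * q k \<le> B" if "k < m" for k
      proof -
        have "q k \<le> (\<Sum>k<m. q k)" by (rule member_le_sum) (use that q0 in auto)
        then have "\<rho> * q k \<le> \<rho> * (\<Sum>k<m. q k)" using \<rho> by simp
        then show ?thesis using Bq by linarith
      qed
      \<comment> \<open>The summand with index 0 alone yields the iteration bound, because
        \<open>e 0 \<le> \<epsilon> / 2\<close>.\<close>
      have "1 / \<epsilon> powr \<alpha> \<le> 1 / e 0 powr \<alpha>"
        using e0 ep[of 0] \<epsilon> \<alpha> by (intro divide_left_mono powr_mono2) auto
      also have "\<dots> = 1 * (1 / e 0 powr \<alpha>)" by simp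
      also have "\<dots> \<le> q 0"
        unfolding q_def using ep[of 0] ep[of "Suc 0"] by (intro mult_right_mono) auto
      finally have "\<rho> * (1 / \<epsilon> powr \<alpha>) \<le> \<rho> * q 0" using \<rho> by (intro mult_left_mono) auto
      also have "\<dots> \<le> B" by (rule summand[OF m0])
      finally have it: "\<rho> * (1 / \<epsilon> powr \<alpha>) \<le> B" .
      have B0: "0 \<le> B" using it \<rho> by (rule_tac order_trans[rotated]) auto
      have "\<rho> * (1 / \<epsilon> powr \<alpha>) * W \<le> (real (mhat_index \<Delta>0 e) + 1) * B"
      proof (cases "\<rho> * (1 / \<epsilon> powr \<alpha>) * W \<le> B")
        case True
        have "1 * B \<le> (real (mhat_index \<Delta>0 e) + 1) * B" using B0 by (intro mult_right_mono) auto
        with True show ?thesis by linarith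
      next
        case False
        \<comment> \<open>On this scale the cap that the small \<open>B\<close> imposes on the
          ratios of consecutive targets becomes an affine recurrence with slope
          \<open>1 + \<alpha>\<close> and \<open>y 0 \<le> 0\<close>.\<close>
        define y where "y = (\<lambda>k. ln (e k / \<epsilon>))"
        have "y m \<le> (1 + \<alpha>) ^ m * (w X / \<alpha>)"
        proof (rule affine_recurrence_le)
          show "y 0 \<le> 0" using e0 ep[of 0] \<epsilon> by (simp add: y_def)
          fix k assume k: "k < m"
          have "\<rho> * q k \<le> \<rho> * ((1 / \<epsilon> powr \<alpha>) * W)" using summand[OF k] False by simp
          then have "q k \<le> (1 / \<epsilon> powr \<alpha>) * W" using \<rho> by (rule mult_left_le_imp_le)
          moreover have "e (Suc k) / e k * (1 / e k powr \<alpha>) \<le> q k"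
            unfolding q_def using ep[of k] ep[of "Suc k"] by (intro mult_right_mono) (auto simp: field_simps)
          ultimately have "e (Suc k) / e k * (1 / e k powr \<alpha>) \<le> (1 / \<epsilon> powr \<alpha>) * W" by linarith
          then have "e (Suc k) / \<epsilon> \<le> W * ((e k / \<epsilon>) * (e k / \<epsilon>) powr \<alpha>)"
            using ep[of k] \<epsilon> by (simp add: powr_divide field_simps)
          then have "ln (e (Suc k) / \<epsilon>) \<le> ln (W * ((e k / \<epsilon>) * (e k / \<epsilon>) powr \<alpha>))"
            using ep[of k] ep[of "Suc k"] \<epsilon> X(2) by (subst ln_le_cancel_iff) (auto simp: W_def)
          also have "\<dots> = ln W + (ln (e k / \<epsilon>) + \<alpha> * ln (e k / \<epsilon>))"
          proof -
            have "ln (W * (x * x powr \<alpha>)) = ln W + (ln x + \<alpha> * ln x)" if "0 < x" for x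
              using that X(2) by (simp add: ln_mult_pos ln_powr W_def)
            from this[of "e k / \<epsilon>"] show ?thesis using ep[of k] \<epsilon> by simp
          qed
          finally show "y (Suc k) \<le> w X + (1 + \<alpha>) * y k"
            by (simp add: y_def w_def W_def algebra_simps)
        qed (use \<alpha> X in auto)
        moreover have "ln (X / 2) \<le> y m"
          unfolding y_def X_def using em \<epsilon> a by (subst ln_le_cancel_iff) (auto simp: field_simps ep)
        ultimately have "ln (X / 2) \<le> (1 + \<alpha>) ^ m * (w X / \<alpha>)" by linarith
        then have "ln (ln (X / 2)) \<le> ln ((1 + \<alpha>) ^ m * (w X / \<alpha>))"
          using X \<alpha> by (subst ln_le_cancel_iff) auto
        also have "\<dots> = real m * ln (1 + \<alpha>) + ln (w X / \<alpha>)"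
          using X \<alpha> by (subst ln_mult_pos) (auto simp: ln_realpow)
        finally have "W / 2 \<le> real m * ln (1 + \<alpha>)" using X(5) by (simp add: W_def)
        \<comment> \<open>\<open>ln (1 + \<alpha>) \<le> \<alpha> < 1 / 2\<close>, so the halves
          cancel and \<open>W \<le> m\<close>.\<close>
        also have "\<dots> \<le> real m * (1 / 2)"
          using ln_add_one_self_le_self[of \<alpha>] \<alpha> by (intro mult_left_mono) auto
        finally have "W \<le> real (mhat_index \<Delta>0 e) + 1" using mm by linarith
        then have "B * W \<le> B * (real (mhat_index \<Delta>0 e) + 1)" using B0 by (rule mult_left_mono)
        moreover have "\<rho> * (1 / \<epsilon> powr \<alpha>) * W \<le> B * W"
          using it X(2) by (intro mult_right_mono) (auto simp: W_def)
        ultimately show ?thesis by (simp add: mult.commute)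
      qed
      with it show "\<rho> * (1 / \<epsilon> powr \<alpha>) \<le> B_bound p L \<mu> \<Delta>0 e \<and>
          \<rho> * (1 / \<epsilon> powr \<alpha>) * ln (ln (\<Delta>0 / \<epsilon>)) \<le> (real (mhat_index \<Delta>0 e) + 1) * B_bound p L \<mu> \<Delta>0 e"
        by (simp add: B_def W_def X_def)
    qed
  qed
qed

lemma no_better_targets_quadratic:
  "no_better_targets 2 (\<lambda>L \<mu> \<Delta>0 \<epsilon>. sqrt (L / \<mu>) * ln (\<Delta>0 / \<epsilon>))
    (\<lambda>L \<mu> \<Delta>0 \<epsilon>. sqrt (L / \<mu>) * (ln (\<Delta>0 / \<epsilon>))\<^sup>2)"
proof (rule no_better_targetsI)
  fix L \<mu> \<Delta>0 :: real assume a: "0 < L" "0 < \<mu>" "0 < \<Delta>0"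
  have "\<forall>\<^sub>F X in at_top. (1::real) < X" by real_asymp
  from eventually_ratio[OF this a(3)] eventually_at_right_less[of 0]
  show "\<forall>\<^sub>F \<epsilon> in at_right 0. \<forall>e\<in>admissible_targets \<epsilon>.
    sqrt (L / \<mu>) * ln (\<Delta>0 / \<epsilon>) \<le> B_bound 2 L \<mu> \<Delta>0 e \<and>
    sqrt (L / \<mu>) * (ln (\<Delta>0 / \<epsilon>))\<^sup>2 \<le> (real (mhat_index \<Delta>0 e) + 1) * B_bound 2 L \<mu> \<Delta>0 e"
  proof eventually_elim
    case (elim \<epsilon>)
    have l0: "0 < ln (\<Delta>0 / \<epsilon>)" using elim by simp
    show ?case
    proof
      fix e assume e: "e \<in> admissible_targets \<epsilon>"
      have ep: "0 < e k" for k using e by (simp add: admissible_targets_def)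
      have e0: "e 0 \<le> \<epsilon> / 2" and inc: "strict_mono e" using e by (auto simp: admissible_targets_def)
      define m where "m = m_index \<Delta>0 e"
      define B where "B = B_bound 2 L \<mu> \<Delta>0 e"
      have em: "\<Delta>0 / 2 \<le> e m" using admissible_indices(1)[OF e] by (simp add: m_def)
      have mm: "m \<le> mhat_index \<Delta>0 e" using admissible_indices(2)[OF e] a by (simp add: m_def)
      \<comment> \<open>The log-ratios sum to at least \<open>ln (\<Delta>0 / \<epsilon>)\<close>,
        and for \<open>p = 2\<close> the bound is a fixed multiple of the sum of
        \<open>1 + 2 * exp (u k)\<close>. It therefore dominates both the sum of the
        \<open>u k\<close> and the sum of their squares.\<close>
      define u where "u = (\<lambda>k. ln (e (Suc k)) - ln (e k))"
      have u0: "0 \<le> u k" for k using strict_monoD[OF inc, of k "Suc k"] ep by (simp add: u_def)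
      have ratio: "e (Suc k) / e k = exp (u k)" for k using ep by (simp add: u_def exp_diff)
      have "\<Delta>0 / \<epsilon> \<le> e m / e 0"
        using frac_le[of "e m" "\<Delta>0 / 2" "e 0" "\<epsilon> / 2"] em e0 ep[of 0] ep[of m] a by simp
      then have "ln (\<Delta>0 / \<epsilon>) \<le> ln (e m / e 0)" using elim ep a by (subst ln_le_cancel_iff) auto
      also have "\<dots> = (\<Sum>k<m. u k)" 
    proof -
      have "ln (e m / e 0) = ln (e m) - ln (e 0)" using ep by (intro ln_divide_pos)
      also have "\<dots> = (\<Sum>k<m. u k)" unfolding u_def by (rule sum_lessThan_telescope[symmetric])
      finally show ?thesis .
    qed
      finally have l: "ln (\<Delta>0 / \<epsilon>) \<le> (\<Sum>k<m. u k)" .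
      have "e k powr 0 = 1" for k using ep[of k] by simp
      then have Beq: "B = 2 * sqrt (L / \<mu>) * (\<Sum>k<m. 1 + 2 * exp (u k))"
        using B_bound_eq[of L \<mu> e 2 \<Delta>0] a ep
        by (simp add: B_def m_def powr_half_sqrt real_sqrt_divide flip: ratio)
      have lower: "sqrt (L / \<mu>) * x \<le> B" if "x \<le> (\<Sum>k<m. 1 + 2 * exp (u k))" "0 \<le> x" for x
      proof -
        have "sqrt (L / \<mu>) * x \<le> 2 * sqrt (L / \<mu>) * (\<Sum>k<m. 1 + 2 * exp (u k))"
          using that a by (intro mult_mono) auto
        then show ?thesis by (simp add: Beq)
      qed
      have "(\<Sum>k<m. u k) \<le> (\<Sum>k<m. 1 + 2 * exp (u k))"
      proof (rule sum_mono)
        fix k show "u k \<le> 1 + 2 * exp (u k)" using exp_ge_add_one_self[of "u k"] u0[of k] by linarith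
      qed
      then have it: "sqrt (L / \<mu>) * ln (\<Delta>0 / \<epsilon>) \<le> B" using l l0 by (intro lower) auto
      have "(\<Sum>k<m. (u k)\<^sup>2) \<le> (\<Sum>k<m. 1 + 2 * exp (u k))"
      proof (rule sum_mono)
        fix k show "(u k)\<^sup>2 \<le> 1 + 2 * exp (u k)"
          using exp_lower_Taylor_quadratic[OF u0[of k]] u0[of k] by linarith
      qed
      then have sq: "sqrt (L / \<mu>) * (\<Sum>k<m. (u k)\<^sup>2) \<le> B" by (intro lower sum_nonneg) auto
      have "(ln (\<Delta>0 / \<epsilon>))\<^sup>2 \<le> (\<Sum>k<m. u k)\<^sup>2" using l l0 by (intro power_mono) auto
      \<comment> \<open>Cauchy-Schwarz; the factor \<open>m\<close> is then paid for by
        \<open>mhat_index \<Delta>0 e\<close>.\<close>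
      also have "\<dots> \<le> real m * (\<Sum>k<m. (u k)\<^sup>2)"
        using sum_squared_le_sum_of_squares[of u "{..<m}"] by (simp add: mult.commute)
      finally have "sqrt (L / \<mu>) * (ln (\<Delta>0 / \<epsilon>))\<^sup>2 \<le> sqrt (L / \<mu>) * (real m * (\<Sum>k<m. (u k)\<^sup>2))"
        using a by (intro mult_left_mono) auto
      also have "\<dots> = real m * (sqrt (L / \<mu>) * (\<Sum>k<m. (u k)\<^sup>2))" by simp
      also have "\<dots> \<le> real m * B" using sq by (intro mult_left_mono) auto
      also have "\<dots> \<le> (real (mhat_index \<Delta>0 e) + 1) * B"
        using mm it l0 a by (intro mult_right_mono) (auto intro: order_trans[rotated])
      finally show "sqrt (L / \<mu>) * ln (\<Delta>0 / \<epsilon>) \<le> B_bound 2 L \<mu> \<Delta>0 e \<and>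
          sqrt (L / \<mu>) * (ln (\<Delta>0 / \<epsilon>))\<^sup>2 \<le> (real (mhat_index \<Delta>0 e) + 1) * B_bound 2 L \<mu> \<Delta>0 e"
        using it by (simp add: B_def)
    qed
  qed
qed

theorem corollary4p3:
  fixes p :: real
  assumes "p \<ge> 2"
  shows
    "(p > 2 \<longrightarrow>
        (let rit = (\<lambda>L \<mu> \<Delta>0 \<epsilon>. sqrt L / \<mu> powr (1 / p) * (1 / \<epsilon> powr (1 / 2 - 1 / p)));
             ror = (\<lambda>L \<mu> \<Delta>0 \<epsilon>. sqrt L / \<mu> powr (1 / p) * (1 / \<epsilon> powr (1 / 2 - 1 / p))
                                   * ln (ln (\<Delta>0 / \<epsilon>)))
         in (\<forall>c::real. 1 < c \<and> c < 3 / 2 - 1 / p \<longrightarrow>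
               complexity_bounds p (\<lambda>\<epsilon> k. \<epsilon> / (2 * exp 1) * exp (c ^ k)) rit ror) \<and>
            no_better_targets p rit ror)) \<and>
     (p = 2 \<longrightarrow>
        (let rit = (\<lambda>L \<mu> \<Delta>0 \<epsilon>. sqrt (L / \<mu>) * ln (\<Delta>0 / \<epsilon>));
             ror = (\<lambda>L \<mu> \<Delta>0 \<epsilon>. sqrt (L / \<mu>) * (ln (\<Delta>0 / \<epsilon>))\<^sup>2)
         in (\<forall>c::real. 1 < c \<longrightarrow>
               complexity_bounds p (\<lambda>\<epsilon> k. \<epsilon> / 2 * c ^ k) rit ror) \<and>
            no_better_targets p rit ror))"
  unfolding Let_def
  using complexity_bounds_superlinear no_better_targets_superlinear
    complexity_bounds_quadratic no_better_targets_quadratic by blast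

end
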